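(* For every $\varepsilon \in (0,1)$ and $\alpha > 0$, there exist $\beta > 0$ and $n_0$ such that the following holds for all integers $n\ge n_0$ and all positive integers $k < (1/2-\alpha)n$. If $P$ is a $\beta n$-sparse $k\times n$ partial Latin rectangle (with symbol set $[n]$) with $\ell$ nonempty entries and $\mathbf{L}$ is chosen uniformly at random from the set $\mathcal{L}_{k,n}$ of $k\times n$ Latin rectangles with symbol set $[n]$, then $$\left(\frac{1-\varepsilon}{n}\right)^\ell \le \mathbb{P}\left[P \subseteq \mathbf{L}\right] \le \left(\frac{1+\varepsilon}{n}\right)^\ell.$$
   Context: $[n] = \{1,\dots,n\}$. For $k\le n$, a $k\times n$ Latin rectangle is a $k\times n$ array of $n$ symbols in which each row contains each symbol exactly once and each column contains each symbol at most once; $\mathcal{L}_{k,n}$ is the set of those with symbol set $[n]$. A $k\times n$ partial Latin rectangle is a partially populated $k\times n$ array of $n$ symbols (some cells may be empty) in which each symbol appears at most once in each row and at most once in each column. It is $C$-sparse if every row and every column has at most $C$ nonempty entries and each symbol is used at most $C$ times. $P\subseteq L$ means that every nonempty entry of $P$ contains the same symbol as the corresponding cell of $L$. *)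

theory Defs
  imports "HOL-Probability.Probability"
begin

text \<open>
  A (possibly partially populated) array is a partial map from cells \<open>(row, column)\<close> to symbols;
  cells outside the domain are empty. With this encoding the relation \<open>P \<subseteq> L\<close>
  is the library's map inclusion \<open>P \<subseteq>\<^sub>m L\<close>, and the number of nonempty entries is \<open>card (dom P)\<close>.
\<close>

type_synonym array = "nat \<times> nat \<rightharpoonup> nat"

definition latin_rectangles :: "nat \<Rightarrow> nat \<Rightarrow> array set" where
  "latin_rectangles k n = {L.
     dom L = {1..k} \<times> {1..n} \<and> ran L \<subseteq> {1..n} \<and>
     (\<forall>i\<in>{1..k}. \<forall>s\<in>{1..n}. \<exists>!j. j \<in> {1..n} \<and> L (i, j) = Some s) \<and>
     (\<forall>j\<in>{1..n}. \<forall>s\<in>{1..n}. \<exists>\<^sub>\<le>\<^sub>1i. i \<in> {1..k} \<and> L (i, j) = Some s)}"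

definition partial_latin_rectangle :: "nat \<Rightarrow> nat \<Rightarrow> array \<Rightarrow> bool" where
  "partial_latin_rectangle k n P \<longleftrightarrow>
     dom P \<subseteq> {1..k} \<times> {1..n} \<and> ran P \<subseteq> {1..n} \<and>
     (\<forall>i\<in>{1..k}. \<forall>s\<in>{1..n}. \<exists>\<^sub>\<le>\<^sub>1j. j \<in> {1..n} \<and> P (i, j) = Some s) \<and>
     (\<forall>j\<in>{1..n}. \<forall>s\<in>{1..n}. \<exists>\<^sub>\<le>\<^sub>1i. i \<in> {1..k} \<and> P (i, j) = Some s)"

definition C_sparse :: "real \<Rightarrow> nat \<Rightarrow> nat \<Rightarrow> array \<Rightarrow> bool" where
  "C_sparse C k n P \<longleftrightarrow>
     (\<forall>i\<in>{1..k}. real (card {j\<in>{1..n}. P (i, j) \<noteq> None}) \<le> C) \<and>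
     (\<forall>j\<in>{1..n}. real (card {i\<in>{1..k}. P (i, j) \<noteq> None}) \<le> C) \<and>
     (\<forall>s\<in>{1..n}. real (card {c\<in>{1..k} \<times> {1..n}. P c = Some s}) \<le> C)"

text \<open>
  The next two facts guarantee that \<open>pmf_of_set (latin_rectangles k n)\<close> really is the uniform
  distribution (it is unspecified for empty or infinite sets) whenever \<open>k \<le> n\<close>.
\<close>

lemma finite_latin_rectangles: "finite (latin_rectangles k n)"
proof (rule finite_subset)
  show "latin_rectangles k n \<subseteq> {L. dom L = {1..k} \<times> {1..n} \<and> ran L \<subseteq> {1..n}}"
    unfolding latin_rectangles_def by blast
  show "finite {L :: array. dom L = {1..k} \<times> {1..n} \<and> ran L \<subseteq> {1..n}}"
    by (rule finite_set_of_finite_maps) auto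
qed

lemma latin_rectangles_nonempty:
  assumes "k \<le> n"
  shows "latin_rectangles k n \<noteq> {}"
proof -
  define f where "f i j = Suc ((i + j) mod n)" for i j :: nat
  define L :: array where
    "L = (\<lambda>(i, j). if i \<in> {1..k} \<and> j \<in> {1..n} then Some (f i j) else None)"
  have comm: "f i j = f j i" for i j
    by (simp add: f_def add.commute)
  have range: "f i j \<in> {1..n}" if "j \<in> {1..n}" for i j
    using that by (auto simp: f_def intro!: Suc_leI)
  have inj_f: "inj_on (f i) {1..n}" for i
  proof -
    have le: "j = j'"
      if "j \<le> j'" "j \<in> {1..n}" "j' \<in> {1..n}" "f i j = f i j'" for j j'
    proof -
      from that have "(i + j) mod n = (i + j') mod n"
        by (simp add: f_def)
      with \<open>j \<le> j'\<close> have "n dvd (i + j') - (i + j)"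
        using mod_eq_dvd_iff_nat[of "i + j" "i + j'" n] by simp
      with that show "j = j'"
        using nat_dvd_not_less[of "j' - j" n] by fastforce
    qed
    show ?thesis
      by (rule inj_onI) (metis le nat_le_linear)
  qed
  have img: "f i ` {1..n} = {1..n}" for i
    by (rule card_subset_eq) (use range inj_f in \<open>auto simp: card_image\<close>)
  have "L \<in> latin_rectangles k n"
    unfolding latin_rectangles_def mem_Collect_eq
  proof (intro conjI ballI)
    show "dom L = {1..k} \<times> {1..n}"
      by (auto simp: L_def dom_def split: if_splits)
    show "ran L \<subseteq> {1..n}"
      using range by (fastforce simp: L_def ran_def split: if_splits)
  next
    fix i s assume i: "i \<in> {1..k}" and "s \<in> {1..n}"
    then obtain j where j: "j \<in> {1..n}" "s = f i j"
      using img[of i] by (metis imageE)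
    show "\<exists>!j. j \<in> {1..n} \<and> L (i, j) = Some s"
      by (rule ex1I[of _ j]) (use i j inj_onD[OF inj_f[of i]] in \<open>simp_all add: L_def split: if_splits\<close>)
  next
    fix j s assume "j \<in> {1..n}" "s \<in> {1..n}"
    show "\<exists>\<^sub>\<le>\<^sub>1i. i \<in> {1..k} \<and> L (i, j) = Some s"
    proof (rule Uniq_I)
      fix i i'
      assume "i \<in> {1..k} \<and> L (i, j) = Some s" "i' \<in> {1..k} \<and> L (i', j) = Some s"
      with \<open>j \<in> {1..n}\<close> assms have "i \<in> {1..n}" "i' \<in> {1..n}" "f j i = f j i'"
        by (auto simp: L_def comm[of j])
      then show "i' = i"
        using inj_f[of j] by (metis inj_onD)
    qed
  qed
  then show ?thesis by blast
qed

end

theory Submission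
  imports Defs
begin

text \<open>
  Write \<open>N(P)\<close> for the number of Latin rectangles that contain \<open>P\<close>. The entries of \<open>P\<close> can be added
  one at a time, so everything reduces to a single entry: if \<open>P\<close> is sparse, the cell \<open>(i, j)\<close> is empty and
  the symbol \<open>a\<close> is still allowed there, then \<open>N(P + (i, j, a))\<close> is \<open>N(P) / n\<close> up to a factor close to \<open>1\<close>
  (\<open>completions_ratio\<close>). As \<open>N(P)\<close> is the sum of \<open>N(P + (i, j, x))\<close> over the allowed symbols \<open>x\<close>, of which
  there are at least \<open>n - 2 f\<close> when rows, columns and symbols of \<open>P\<close> have at most \<open>f\<close> entries, it suffices
  that the summands for any two allowed symbols \<open>a\<close> and \<open>b\<close> are nearly equal (\<open>completions_comparison\<close>).

  The comparison is a Kempe change. Let two rows of \<open>L\<close> touch if in some column one of them has \<open>a\<close> and the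
  other has \<open>b\<close>, and let \<open>T\<close> be the component of row \<open>i\<close> for this relation. Exchanging \<open>a\<close> and \<open>b\<close> in the
  rows of \<open>T\<close> gives another Latin rectangle with the same component, so the exchange is an involution, and it
  replaces \<open>a\<close> by \<open>b\<close> in \<open>(i, j)\<close>. It respects \<open>P\<close> unless \<open>T\<close> contains a bad row, that is, one in which
  \<open>P\<close> uses \<open>a\<close> or \<open>b\<close>. Hence only rectangles whose component meets a bad row have to be counted. Since each
  of \<open>a\<close> and \<open>b\<close> occurs once in a row and at most once in a column, \<open>T\<close> is a path or a cycle, and a bad row
  in it is reached from \<open>i\<close> by walking along it in one of the two directions (\<open>component_directed\<close>).

  Such walks are controlled by exchanging two entries of a single row. An entry \<open>x\<close> in column \<open>c\<close> may trade
  places with the entry of column \<open>c'\<close> unless \<open>x\<close> occurs in column \<open>c'\<close> or the other entry occurs in column \<open>c\<close>;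
  each condition excludes at most \<open>k\<close> columns, so about \<open>n - 2 k \<ge> 2 \<alpha> n\<close> choices remain. This is where
  \<open>k < (1/2 - \<alpha>) n\<close> enters. Moving the next symbol \<open>a\<close> on the walk out of its column ends the walk there, and
  conversely there are at most \<open>k\<close> ways to undo this; so at every step a positive proportion of the walks ends,
  and the total number of walk steps is only a constant times the number of rectangles (\<open>long_chain_sum\<close>).
  A walk that is about to enter a bad row is switched in the same way, but now only \<open>O(f)\<close> ways lead back, because
  the row or the column of the moved entry is one of \<open>O(f)\<close> that are determined by \<open>P\<close> (\<open>hits_column_bound\<close>,
  \<open>hits_row_bound\<close>). With \<open>f \<le> \<beta> n\<close> the bad rectangles make up a proportion \<open>O(\<beta>)\<close> (\<open>reach_bound\<close>).
\<close>

section \<open>Rows and columns of Latin rectangles\<close>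

lemma latin_rectangle_cellD:
  assumes "L \<in> latin_rectangles k n" "L (r, c) = Some x"
  shows "r \<in> {1..k}" "c \<in> {1..n}" "x \<in> {1..n}"
proof -
  have "(r, c) \<in> dom L" "x \<in> ran L" using assms(2) by (auto simp: ran_def)
  then show "r \<in> {1..k}" "c \<in> {1..n}" "x \<in> {1..n}"
    using assms(1) unfolding latin_rectangles_def by blast+
qed

lemma latin_rectangle_filled:
  assumes "L \<in> latin_rectangles k n" "r \<in> {1..k}" "c \<in> {1..n}"
  obtains x where "L (r, c) = Some x" "x \<in> {1..n}"
proof -
  have "(r, c) \<in> dom L" using assms unfolding latin_rectangles_def by blast
  then obtain x where "L (r, c) = Some x" by blast
  with that latin_rectangle_cellD(3)[OF assms(1) this] show ?thesis by blast
qed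

lemma latin_rectangle_row_unique:
  assumes "L \<in> latin_rectangles k n" "L (r, c) = Some x" "L (r, c') = Some x"
  shows "c = c'"
proof -
  have "\<exists>!c. c \<in> {1..n} \<and> L (r, c) = Some x"
    using assms(1) latin_rectangle_cellD[OF assms(1,2)] unfolding latin_rectangles_def by blast
  then show ?thesis using assms(2,3) latin_rectangle_cellD(2)[OF assms(1)] by blast
qed

lemma latin_rectangle_col_unique:
  assumes "L \<in> latin_rectangles k n" "L (r, c) = Some x" "L (r', c) = Some x"
  shows "r = r'"
proof -
  have "\<exists>\<^sub>\<le>\<^sub>1r. r \<in> {1..k} \<and> L (r, c) = Some x"
    using assms(1) latin_rectangle_cellD[OF assms(1,2)] unfolding latin_rectangles_def by blast
  then show ?thesis
    using assms(2,3) latin_rectangle_cellD(1)[OF assms(1)] by (auto simp: Uniq_def)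
qed

text \<open>
  An injective row of length \<open>n\<close> with entries among \<open>n\<close> symbols contains every symbol, so uniqueness in rows
  and columns suffices.
\<close>

lemma latin_rectangleI:
  assumes dom: "dom L = {1..k} \<times> {1..n}" and ran: "ran L \<subseteq> {1..n}"
    and row: "\<And>r c c' x. L (r, c) = Some x \<Longrightarrow> L (r, c') = Some x \<Longrightarrow> c = c'"
    and col: "\<And>r r' c x. L (r, c) = Some x \<Longrightarrow> L (r', c) = Some x \<Longrightarrow> r = r'"
  shows "L \<in> latin_rectangles k n"
proof -
  have ex: "\<exists>c. c \<in> {1..n} \<and> L (r, c) = Some x" if r: "r \<in> {1..k}" and x: "x \<in> {1..n}" for r x
  proof -
    define g where "g c = the (L (r, c))" for c
    have g: "L (r, c) = Some (g c)" if "c \<in> {1..n}" for c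
    proof -
      have "(r, c) \<in> dom L" using dom r that by blast
      then show ?thesis by (auto simp: g_def)
    qed
    have "inj_on g {1..n}" by (rule inj_onI) (metis g row)
    moreover have sub: "g ` {1..n} \<subseteq> {1..n}" using g ran by (fastforce simp: ran_def)
    ultimately have "g ` {1..n} = {1..n}" by (simp add: endo_inj_surj)
    then show ?thesis using x g by (metis imageE)
  qed
  show ?thesis unfolding latin_rectangles_def mem_Collect_eq
  proof (intro conjI ballI dom ran)
    show "\<exists>!c. c \<in> {1..n} \<and> L (r, c) = Some x" if "r \<in> {1..k}" "x \<in> {1..n}" for r x
      using ex[OF that] row by blast
    show "\<exists>\<^sub>\<le>\<^sub>1r. r \<in> {1..k} \<and> L (r, c) = Some x" for c x
      by (rule Uniq_I) (blast intro: col)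
  qed
qed

section \<open>Exchanging two entries of a row\<close>

definition swap_cells :: "array \<Rightarrow> nat \<Rightarrow> nat \<Rightarrow> nat \<Rightarrow> array" where
  "swap_cells L r c c' = (\<lambda>(q, d). L (q, if q = r then Transposition.transpose c c' d else d))"

definition switchable :: "nat \<Rightarrow> array \<Rightarrow> nat \<Rightarrow> nat \<Rightarrow> nat set" where
  "switchable n L r c =
     {c' \<in> {1..n}. (\<forall>r'. L (r', c') \<noteq> L (r, c)) \<and> (\<forall>r'. L (r', c) \<noteq> L (r, c'))}"

lemma swap_cells_other_row: "r' \<noteq> r \<Longrightarrow> swap_cells L r c c' (r', d) = L (r', d)"
  by (simp add: swap_cells_def)

lemma swap_cells_row: "swap_cells L r c c' (r, d) = L (r, Transposition.transpose c c' d)"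
  by (simp add: swap_cells_def)

lemma swap_cells_apply:
  assumes "c' \<in> switchable n L r c"
  shows "swap_cells L r c c' (r, c) = L (r, c')" "swap_cells L r c c' (r, c') = L (r, c)" "c' \<noteq> c"
  using assms by (auto simp: swap_cells_row switchable_def)

lemma swap_cells_latin:
  assumes L: "L \<in> latin_rectangles k n" and rc: "L (r, c) = Some x" and c': "c' \<in> switchable n L r c"
  shows "swap_cells L r c c' \<in> latin_rectangles k n"
proof (rule latin_rectangleI)
  note row = latin_rectangle_row_unique[OF L] and col = latin_rectangle_col_unique[OF L]
  let ?M = "swap_cells L r c c'" and ?t = "Transposition.transpose c c'"
  have rng: "c \<in> {1..n}" "c' \<in> {1..n}"
    using latin_rectangle_cellD[OF L rc] c' by (auto simp: switchable_def)
  have t: "?t d \<in> {1..n} \<longleftrightarrow> d \<in> {1..n}" for d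
    using rng by (simp add: Transposition.transpose_def)
  have dom_L: "dom L = {1..k} \<times> {1..n}" using L by (simp add: latin_rectangles_def)
  have "(q, d) \<in> dom ?M \<longleftrightarrow> (q, d) \<in> {1..k} \<times> {1..n}" for q d
  proof -
    have "(q, d) \<in> dom ?M \<longleftrightarrow> (q, if q = r then ?t d else d) \<in> dom L"
      by (simp add: swap_cells_def domIff)
    also have "\<dots> \<longleftrightarrow> (q, d) \<in> {1..k} \<times> {1..n}"
      unfolding dom_L mem_Times_iff using t by (simp del: atLeastAtMost_iff)
    finally show ?thesis .
  qed
  then show "dom ?M = {1..k} \<times> {1..n}" by (metis subrelI subset_antisym)
  have "ran ?M \<subseteq> ran L" by (auto simp: swap_cells_def ran_def)
  then show "ran ?M \<subseteq> {1..n}" using L by (auto simp: latin_rectangles_def)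
  show "d = d'" if "?M (q, d) = Some z" "?M (q, d') = Some z" for q d d' z
  proof (cases "q = r")
    case True
    with that have "?t d = ?t d'" by (intro row) (simp_all add: swap_cells_row)
    then show ?thesis by (metis transpose_involutory)
  next
    case False
    with that show ?thesis by (intro row) (simp_all add: swap_cells_other_row)
  qed
  have mixed: False if q: "q \<noteq> r" and M: "?M (r, d) = Some z" "?M (q, d) = Some z" for q d z
  proof -
    have eq: "L (r, ?t d) = Some z" "L (q, d) = Some z"
      using q M by (simp_all add: swap_cells_row swap_cells_other_row)
    show False
    proof (cases "d = c \<or> d = c'")
      case True
      with eq have "L (q, c) = L (r, c') \<or> L (q, c') = L (r, c)" by auto
      with c' show False by (auto simp: switchable_def)
    next
      case False
      with eq col q show False by (metis transpose_apply_other)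
    qed
  qed
  show "q = q'" if "?M (q, d) = Some z" "?M (q', d) = Some z" for q q' d z
  proof (cases "q = r \<or> q' = r")
    case True
    with that mixed show ?thesis by metis
  next
    case False
    with that show ?thesis by (intro col) (simp_all add: swap_cells_other_row)
  qed
qed

text \<open>
  Each of the two conditions excludes at most \<open>k\<close> columns: \<open>x\<close> occurs once in each of the \<open>k\<close> rows, and
  column \<open>c\<close> has \<open>k\<close> entries, each of which occurs once in row \<open>r\<close>. Column \<open>c\<close> itself is among those excluded.
\<close>

lemma card_switchable:
  assumes L: "L \<in> latin_rectangles k n" and rc: "L (r, c) = Some x"
  shows "n - 2 * k \<le> card (switchable n L r c)"
proof -
  let ?A = "{c' \<in> {1..n}. \<exists>r'. L (r', c') = L (r, c)}"
  let ?B = "{c' \<in> {1..n}. \<exists>r'. L (r', c) = L (r, c')}"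
  note row = latin_rectangle_row_unique[OF L] and cell = latin_rectangle_cellD[OF L]
  have "?A \<subseteq> (\<lambda>r'. THE c'. L (r', c') = L (r, c)) ` {1..k}"
  proof
    fix c' assume "c' \<in> ?A"
    then obtain r' where r': "L (r', c') = L (r, c)" by blast
    then have "(THE c'. L (r', c') = L (r, c)) = c'" using rc row by (intro the_equality) auto
    moreover have "r' \<in> {1..k}" using cell r' rc by metis
    ultimately show "c' \<in> (\<lambda>r'. THE c'. L (r', c') = L (r, c)) ` {1..k}" by force
  qed
  from surj_card_le[OF _ this] have A: "card ?A \<le> k" by simp
  have "?B \<subseteq> (\<lambda>r'. THE c'. L (r', c) = L (r, c')) ` {1..k}"
  proof
    fix c' assume c': "c' \<in> ?B"
    then obtain r' where r': "L (r', c) = L (r, c')" by blast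
    obtain y where y: "L (r, c') = Some y"
      using c' cell(1)[OF rc] latin_rectangle_filled[OF L] by blast
    have "(THE c'. L (r', c) = L (r, c')) = c'" using r' y row by (intro the_equality) auto
    moreover have "r' \<in> {1..k}" using cell r' y by metis
    ultimately show "c' \<in> (\<lambda>r'. THE c'. L (r', c) = L (r, c')) ` {1..k}" by force
  qed
  from surj_card_le[OF _ this] have B: "card ?B \<le> k" by simp
  have "switchable n L r c = {1..n} - (?A \<union> ?B)" by (auto simp: switchable_def)
  moreover have "card {1..n} - card (?A \<union> ?B) \<le> card ({1..n} - (?A \<union> ?B))"
    by (rule diff_card_le_card_Diff) simp
  moreover have "card (?A \<union> ?B) \<le> 2 * k" using A B card_Un_le[of ?A ?B] by linarith
  ultimately show ?thesis by simp
qed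

lemma double_counting:
  assumes "finite A" "finite B"
    and "\<And>x. x \<in> A \<Longrightarrow> D \<le> card {y \<in> B. S x y}"
    and "\<And>y. y \<in> B \<Longrightarrow> card {x \<in> A. S x y} \<le> d"
  shows "D * card A \<le> d * card B"
proof -
  have "D * card A = (\<Sum>x\<in>A. D)" by simp
  also have "\<dots> \<le> (\<Sum>x\<in>A. card {y \<in> B. S x y})" by (rule sum_mono) (rule assms(3))
  also have "\<dots> = (\<Sum>y\<in>B. card {x \<in> A. S x y})"
    by (rule sum_multicount_gen) (use assms in auto)
  also have "\<dots> \<le> (\<Sum>y\<in>B. d)" by (rule sum_mono) (rule assms(4))
  finally show ?thesis by (simp add: mult.commute)
qed

text \<open>
  The switching argument in the form used throughout: from every rectangle in \<open>A\<close> an entry \<open>x\<close> can be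
  switched so as to land in \<open>B\<close>, and \<open>W M\<close> lists the cells from which the moved \<open>x\<close> of \<open>M \<in> B\<close> may have
  come. To undo a switch only this cell is needed, as the other cell is where \<open>x\<close> stands in the same row of \<open>M\<close>.
  The sets \<open>F\<close> hold columns whose entries must stay in place.
\<close>

lemma switching_bound:
  assumes A: "A \<subseteq> latin_rectangles k n" and B: "B \<subseteq> latin_rectangles k n"
    and fwd: "\<And>L. L \<in> A \<Longrightarrow> \<exists>r c F. L (r, c) = Some x \<and> finite F \<and> card F \<le> f \<and>
      (\<forall>c' \<in> switchable n L r c - F. swap_cells L r c c' \<in> B \<and> (r, c) \<in> W (swap_cells L r c c'))"
    and bwd: "\<And>M. M \<in> B \<Longrightarrow> finite (W M) \<and> card (W M) \<le> d"
  shows "(n - 2 * k - f) * card A \<le> d * card B"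
proof (rule double_counting)
  let ?S = "\<lambda>L M. \<exists>r c c'. L (r, c) = Some x \<and> c' \<in> switchable n L r c \<and>
    M = swap_cells L r c c' \<and> (r, c) \<in> W M"
  show "finite A" "finite B" using A B finite_latin_rectangles finite_subset by blast+
  show "n - 2 * k - f \<le> card {M \<in> B. ?S L M}" if LA: "L \<in> A" for L
  proof -
    obtain r c F where rc: "L (r, c) = Some x" and F: "finite F" "card F \<le> f"
      and sw: "\<forall>c' \<in> switchable n L r c - F. swap_cells L r c c' \<in> B \<and> (r, c) \<in> W (swap_cells L r c c')"
      using fwd[OF LA] by blast
    let ?J = "switchable n L r c - F"
    have L: "L \<in> latin_rectangles k n" using LA A by blast
    have "inj_on (swap_cells L r c) ?J"
    proof (rule inj_onI)
      fix d d' assume d: "d \<in> ?J" "d' \<in> ?J" and eq: "swap_cells L r c d = swap_cells L r c d'"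
      have dd: "d \<in> switchable n L r c" "d' \<in> switchable n L r c" using d by auto
      have "swap_cells L r c d (r, d) = Some x" "swap_cells L r c d (r, d') = Some x"
        using swap_cells_apply(2)[OF dd(1)] swap_cells_apply(2)[OF dd(2)] eq rc by simp_all
      then show "d = d'" by (rule latin_rectangle_row_unique[OF swap_cells_latin[OF L rc dd(1)]])
    qed
    then have "card ?J = card (swap_cells L r c ` ?J)" by (simp add: card_image)
    also have "\<dots> \<le> card {M \<in> B. ?S L M}"
    proof (rule card_mono)
      show "finite {M \<in> B. ?S L M}" using \<open>finite B\<close> by simp
      show "swap_cells L r c ` ?J \<subseteq> {M \<in> B. ?S L M}"
      proof
        fix M assume "M \<in> swap_cells L r c ` ?J"
        then obtain c' where "c' \<in> ?J" "M = swap_cells L r c c'" by (rule imageE)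
        with sw rc show "M \<in> {M \<in> B. ?S L M}" by blast
      qed
    qed
    finally have "card ?J \<le> card {M \<in> B. ?S L M}" .
    moreover have "card (switchable n L r c) - card F \<le> card ?J"
      by (rule diff_card_le_card_Diff) (rule F(1))
    ultimately show ?thesis using card_switchable[OF L rc] F(2) by linarith
  qed
  show "card {L \<in> A. ?S L M} \<le> d" if MB: "M \<in> B" for M
  proof -
    have M: "M \<in> latin_rectangles k n" using MB B by blast
    have "{L \<in> A. ?S L M} \<subseteq> (\<lambda>(r, c). swap_cells M r c (THE c'. M (r, c') = Some x)) ` W M"
    proof
      fix L assume "L \<in> {L \<in> A. ?S L M}"
      then obtain r c c' where rc: "L (r, c) = Some x" and c': "c' \<in> switchable n L r c"
        and MS: "M = swap_cells L r c c'" and W: "(r, c) \<in> W M" by blast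
      have "M (r, c') = Some x" using MS rc swap_cells_apply(2)[OF c'] by simp
      then have "(THE c'. M (r, c') = Some x) = c'"
        using latin_rectangle_row_unique[OF M] by blast
      moreover have "L = swap_cells M r c c'"
        by (auto simp: MS swap_cells_def)
      ultimately show "L \<in> (\<lambda>(r, c). swap_cells M r c (THE c'. M (r, c') = Some x)) ` W M"
        using W by force
    qed
    then have "card {L \<in> A. ?S L M} \<le> card (W M)"
      by (rule surj_card_le[OF conjunct1[OF bwd[OF MB]]])
    also have "\<dots> \<le> d" using bwd[OF MB] by (rule conjunct2)
    finally show ?thesis .
  qed
qed

section \<open>Chains of two symbols\<close>

definition completions :: "nat \<Rightarrow> nat \<Rightarrow> array \<Rightarrow> array set" where
  "completions k n P = {L \<in> latin_rectangles k n. P \<subseteq>\<^sub>m L}"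

lemma finite_completions: "finite (completions k n P)"
  unfolding completions_def using finite_latin_rectangles by simp

text \<open>
  A step of the walk goes from the symbol \<open>b\<close> of a row up or down its column to the symbol \<open>a\<close>. Exchanging
  the roles of \<open>a\<close> and \<open>b\<close> reverses the steps, so only one direction has to be studied.
\<close>

definition link :: "nat \<Rightarrow> nat \<Rightarrow> array \<Rightarrow> (nat \<times> nat) set" where
  "link a b L = {(r, r'). \<exists>c. L (r, c) = Some b \<and> L (r', c) = Some a}"

lemma link_converse: "(link a b L)\<inverse> = link b a L"
  by (auto simp: link_def)

lemma link_right_unique:
  assumes "L \<in> latin_rectangles k n" "(r, q) \<in> link a b L" "(r, q') \<in> link a b L"
  shows "q = q'"
  using assms latin_rectangle_row_unique[OF assms(1)] latin_rectangle_col_unique[OF assms(1)]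
  unfolding link_def by blast

lemma link_left_unique:
  assumes "L \<in> latin_rectangles k n" "(q, r) \<in> link a b L" "(q', r) \<in> link a b L"
  shows "q = q'"
  using link_right_unique[OF assms(1), of r q b a q'] assms(2,3) link_converse[of a b L] by blast

lemma relpow_right_unique:
  fixes R :: "('a \<times> 'a) set"
  assumes "\<And>x y z. (x, y) \<in> R \<Longrightarrow> (x, z) \<in> R \<Longrightarrow> y = z"
    and "(x, y) \<in> R ^^ t" "(x, z) \<in> R ^^ t"
  shows "y = z"
  using assms(2,3)
proof (induction t arbitrary: y z)
  case 0
  then show ?case by simp
next
  case (Suc t)
  then obtain y' z' where "(x, y') \<in> R ^^ t" "(y', y) \<in> R" "(x, z') \<in> R ^^ t" "(z', z) \<in> R" by auto
  with Suc.IH assms(1) show ?case by blast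
qed

text \<open>
  A walk that never returns to its start visits no point twice: two visits could be traced back, by injectivity
  of the relation, to a visit of the start at a positive time.
\<close>

lemma relpow_level_unique:
  fixes R :: "('a \<times> 'a) set"
  assumes left: "\<And>x y z. (x, z) \<in> R \<Longrightarrow> (y, z) \<in> R \<Longrightarrow> x = y"
    and start: "i \<notin> Range R"
    and "(i, x) \<in> R ^^ t" "(i, x) \<in> R ^^ u"
  shows "t = u"
  using assms(3,4)
proof (induction t arbitrary: u x)
  case 0
  then show ?case using start by (cases u) auto
next
  case (Suc t)
  from Suc.prems(1) obtain y where y: "(i, y) \<in> R ^^ t" "(y, x) \<in> R" by auto
  show ?case
  proof (cases u)
    case 0
    with Suc.prems(2) y start show ?thesis by auto
  next
    case (Suc v)
    with Suc.prems(2) obtain z where "(i, z) \<in> R ^^ v" "(z, x) \<in> R" by auto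
    with y left Suc.IH Suc show ?thesis by blast
  qed
qed

lemma relpow_transfer:
  fixes R R' :: "('a \<times> 'a) set"
  assumes "(x, y) \<in> R ^^ t"
    and "\<And>u p q. u < t \<Longrightarrow> (x, p) \<in> R ^^ u \<Longrightarrow> (p, q) \<in> R \<Longrightarrow> (x, q) \<in> R ^^ Suc u \<Longrightarrow> (p, q) \<in> R'"
  shows "(x, y) \<in> R' ^^ t"
  using assms
proof (induction t arbitrary: y)
  case 0
  then show ?case by simp
next
  case (Suc t)
  from Suc.prems(1) obtain z where z: "(x, z) \<in> R ^^ t" "(z, y) \<in> R" by auto
  have "(x, z) \<in> R' ^^ t" using z(1) Suc.prems(2) less_SucI by (intro Suc.IH) blast+
  moreover have "(z, y) \<in> R'" using Suc.prems(1,2) z by blast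
  ultimately show ?case by auto
qed

lemma card_le_1I:
  assumes "\<And>x y. x \<in> A \<Longrightarrow> y \<in> A \<Longrightarrow> x = y"
  shows "finite A \<and> card A \<le> 1"
proof (cases "A = {}")
  case False
  then obtain x where "x \<in> A" by blast
  with assms have "A = {x}" by blast
  then show ?thesis by simp
qed simp

text \<open>
  The walk follows \<open>link a b\<close> from row \<open>i\<close> in rectangles that have the symbol \<open>s\<close> in the cell \<open>(i, j)\<close>.
  Keeping \<open>s\<close> apart from \<open>a\<close> and \<open>b\<close> lets the two directions of a walk be handled by exchanging \<open>a\<close> and
  \<open>b\<close> while \<open>s\<close> stays the same.
\<close>

locale two_symbol_chain =
  fixes k n f :: nat and P :: array and i j a b s :: nat
  assumes symbols: "a \<noteq> b"
    and row_free: "\<And>c. P (i, c) \<noteq> Some a" "\<And>c. P (i, c) \<noteq> Some b"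
    and col_free: "\<And>r. P (r, j) \<noteq> Some a"
    and dom_P: "dom P \<subseteq> {1..k} \<times> {1..n}"
    and row_sparse: "\<And>r. r \<in> {1..k} \<Longrightarrow> card {c \<in> {1..n}. P (r, c) \<noteq> None} \<le> f"
    and symbol_sparse: "\<And>x. x = a \<or> x = b \<Longrightarrow> card {p \<in> {1..k} \<times> {1..n}. P p = Some x} \<le> f"
    and cell_empty: "P (i, j) = None"
begin

definition hosts :: "array set" where
  "hosts = {L \<in> latin_rectangles k n. P \<subseteq>\<^sub>m L \<and> L (i, j) = Some s}"

definition bad_rows :: "nat set" where
  "bad_rows = {r. \<exists>c. P (r, c) = Some a \<or> P (r, c) = Some b}"

text \<open>
  The walk is stopped before it enters a bad row, and also before it closes up at \<open>i\<close>; it is therefore a path.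
  A walk that closes up without meeting a bad row is harmless.
\<close>

definition chain :: "array \<Rightarrow> (nat \<times> nat) set" where
  "chain L = {(r, q) \<in> link a b L. q \<notin> bad_rows \<and> q \<noteq> i}"

definition long_chain :: "nat \<Rightarrow> array set" where
  "long_chain t = {L \<in> hosts. \<exists>r. (i, r) \<in> chain L ^^ t}"

text \<open>
  A chain of length \<open>t\<close> can run into a bad row in two ways, and they need different switches. Here the
  symbol \<open>a\<close> that continues the walk is itself an entry of \<open>P\<close>. It cannot be moved, so the preceding
  \<open>b\<close> is moved instead; its column is one of the few in which \<open>P\<close> has \<open>a\<close>.
\<close>

definition hits_column :: "nat \<Rightarrow> array set" where
  "hits_column t = {L \<in> hosts. \<exists>r q c. (i, r) \<in> chain L ^^ t \<and> L (r, c) = Some b \<and> P (q, c) = Some a}"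

text \<open>
  Here the continuing \<open>a\<close> is not in \<open>P\<close>, and the row is bad because of an entry \<open>b\<close> of \<open>P\<close>. This \<open>a\<close> can be
  moved, and its row is one of the few bad ones.
\<close>

definition hits_row :: "nat \<Rightarrow> array set" where
  "hits_row t = {L \<in> hosts. \<exists>r q c. (i, r) \<in> chain L ^^ t \<and> L (r, c) = Some b \<and> L (q, c) = Some a \<and>
     q \<in> bad_rows \<and> (\<forall>d. P (q, d) \<noteq> Some a)}"

lemma host_latin: "L \<in> hosts \<Longrightarrow> L \<in> latin_rectangles k n"
  by (simp add: hosts_def)

lemma finite_hosts: "finite hosts"
  unfolding hosts_def using finite_latin_rectangles by simp

lemma long_chain_subset: "long_chain t \<subseteq> hosts" and hits_column_subset: "hits_column t \<subseteq> hosts" and hits_row_subset: "hits_row t \<subseteq> hosts"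
  by (auto simp: long_chain_def hits_column_def hits_row_def)

lemma i_not_bad: "i \<notin> bad_rows"
  using row_free by (simp add: bad_rows_def)

lemma host_extends: "L \<in> hosts \<Longrightarrow> P (r, c) = Some x \<Longrightarrow> L (r, c) = Some x"
  unfolding hosts_def map_le_def by (metis (mono_tags, lifting) domI mem_Collect_eq)

lemma bad_rows_card: "finite bad_rows" "card bad_rows \<le> 2 * f"
proof -
  let ?S = "\<lambda>x. {p \<in> {1..k} \<times> {1..n}. P p = Some x}"
  have sub: "bad_rows \<subseteq> fst ` (?S a \<union> ?S b)"
  proof
    fix r assume "r \<in> bad_rows"
    then obtain c where c: "P (r, c) = Some a \<or> P (r, c) = Some b" by (auto simp: bad_rows_def)
    then have "(r, c) \<in> dom P" by auto
    then have "(r, c) \<in> ?S a \<union> ?S b" using dom_P c by blast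
    then show "r \<in> fst ` (?S a \<union> ?S b)" by force
  qed
  have fin: "finite (?S a \<union> ?S b)" by simp
  show "finite bad_rows" by (rule finite_surj[OF fin sub])
  have "card bad_rows \<le> card (?S a \<union> ?S b)" by (rule surj_card_le[OF fin sub])
  also have "\<dots> \<le> card (?S a) + card (?S b)" by (rule card_Un_le)
  also have "\<dots> \<le> 2 * f" using symbol_sparse[of a] symbol_sparse[of b] by linarith
  finally show "card bad_rows \<le> 2 * f" .
qed

lemma bad_cols_card: "finite {c. \<exists>q. P (q, c) = Some a}" "card {c. \<exists>q. P (q, c) = Some a} \<le> f"
proof -
  let ?S = "{p \<in> {1..k} \<times> {1..n}. P p = Some a}"
  have sub: "{c. \<exists>q. P (q, c) = Some a} \<subseteq> snd ` ?S"
  proof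
    fix c assume "c \<in> {c. \<exists>q. P (q, c) = Some a}"
    then obtain q where q: "P (q, c) = Some a" by blast
    then have "(q, c) \<in> ?S" using dom_P by blast
    then show "c \<in> snd ` ?S" by force
  qed
  show "finite {c. \<exists>q. P (q, c) = Some a}" using finite_surj[OF _ sub] by simp
  show "card {c. \<exists>q. P (q, c) = Some a} \<le> f"
    using surj_card_le[OF _ sub] symbol_sparse[of a] by simp
qed

lemma chain_right_unique: "L \<in> hosts \<Longrightarrow> (x, y) \<in> chain L \<Longrightarrow> (x, z) \<in> chain L \<Longrightarrow> y = z"
  using link_right_unique[OF host_latin] by (auto simp: chain_def)

lemma chain_left_unique: "L \<in> hosts \<Longrightarrow> (x, z) \<in> chain L \<Longrightarrow> (y, z) \<in> chain L \<Longrightarrow> x = y"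
  using link_left_unique[OF host_latin] by (auto simp: chain_def)

lemma start_not_in_range: "i \<notin> Range (chain L)"
  by (auto simp: chain_def)

lemma level_right_unique:
  assumes L: "L \<in> hosts" and "(i, x) \<in> chain L ^^ t" "(i, y) \<in> chain L ^^ t"
  shows "x = y"
  by (rule relpow_right_unique[OF chain_right_unique[OF L] assms(2,3)])

lemma level_unique:
  assumes L: "L \<in> hosts" and "(i, x) \<in> chain L ^^ t" "(i, x) \<in> chain L ^^ u"
  shows "t = u"
  by (rule relpow_level_unique[OF chain_left_unique[OF L] start_not_in_range assms(2,3)])

lemma level_cases:
  assumes "(i, x) \<in> chain L ^^ t"
  shows "x = i \<or> x \<notin> bad_rows \<and> x \<noteq> i"
  using assms by (cases t) (auto simp: chain_def)

text \<open>
  Column \<open>j\<close> is included because the entry \<open>s\<close> in \<open>(i, j)\<close> must stay in place; including it for every row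
  avoids a case distinction.
\<close>

definition protected :: "nat \<Rightarrow> nat set" where
  "protected r = insert j {c \<in> {1..n}. P (r, c) \<noteq> None}"

lemma protected_card: "r \<in> {1..k} \<Longrightarrow> finite (protected r) \<and> card (protected r) \<le> Suc f"
  unfolding protected_def using row_sparse[of r]
  by (auto intro!: order.trans[OF card_insert_le_m1] simp: card_insert_if)

lemma swap_in_host:
  assumes L: "L \<in> hosts" and rc: "L (r, c) = Some x" and c': "c' \<in> switchable n L r c - protected r"
    and free: "P (r, c) = None" "(r, c) \<noteq> (i, j)"
  shows "swap_cells L r c c' \<in> hosts"
proof -
  let ?M = "swap_cells L r c c'"
  have c'': "c' \<in> switchable n L r c" "P (r, c') = None" "c' \<noteq> j" "c' \<in> {1..n}"
    using c' by (auto simp: protected_def switchable_def)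
  have "?M \<in> latin_rectangles k n" by (rule swap_cells_latin[OF host_latin[OF L] rc c''(1)])
  moreover have same: "?M (q, d) = L (q, d)" if "(q, d) \<noteq> (r, c)" "(q, d) \<noteq> (r, c')" for q d
    using that by (auto simp: swap_cells_def)
  have "?M (q, d) = Some z" if "P (q, d) = Some z" for q d z
  proof -
    have "(q, d) \<noteq> (r, c)" "(q, d) \<noteq> (r, c')" using that free(1) c''(2) by auto
    with same host_extends[OF L that] show ?thesis by simp
  qed
  then have "P \<subseteq>\<^sub>m ?M" by (force simp: map_le_def)
  moreover have "?M (i, j) = Some s" using same[of i j] free(2) c''(3) L by (auto simp: hosts_def)
  ultimately show ?thesis by (simp add: hosts_def)
qed

text \<open>
  A row is on the chain because of its own entries and those of other visited rows only.
\<close>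

lemma chain_swap_unvisited:
  assumes L: "L \<in> hosts" and r: "(i, r) \<in> chain L ^^ t"
    and unvisited: "\<And>u. u \<le> t \<Longrightarrow> (i, q) \<notin> chain L ^^ u"
  shows "(i, r) \<in> chain (swap_cells L q c c') ^^ t"
proof (rule relpow_transfer[OF r])
  fix u x y assume u: "u < t" "(i, x) \<in> chain L ^^ u" "(x, y) \<in> chain L" "(i, y) \<in> chain L ^^ Suc u"
  then have "x \<noteq> q" "y \<noteq> q" using unvisited[of u] unvisited[of "Suc u"] by auto
  with u(3) show "(x, y) \<in> chain (swap_cells L q c c')"
    by (auto simp: chain_def link_def swap_cells_other_row)
qed

text \<open>
  At most one column: the one in which a chain of length \<open>t\<close> leaves its last row, i.e. where that row has \<open>b\<close>.
\<close>

definition end_cols :: "nat \<Rightarrow> array \<Rightarrow> nat set" where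
  "end_cols t M = {c. \<exists>r. (i, r) \<in> chain M ^^ t \<and> M (r, c) = Some b}"

lemma end_cols_card: "M \<in> hosts \<Longrightarrow> finite (end_cols t M) \<and> card (end_cols t M) \<le> 1"
proof -
  assume M: "M \<in> hosts"
  have "c = d" if "c \<in> end_cols t M" "d \<in> end_cols t M" for c d
  proof -
    from that obtain r r' where r: "(i, r) \<in> chain M ^^ t" "M (r, c) = Some b"
      and r': "(i, r') \<in> chain M ^^ t" "M (r', d) = Some b" by (auto simp: end_cols_def)
    have "r = r'" by (rule level_right_unique[OF M r(1) r'(1)])
    with r(2) r'(2) show ?thesis using latin_rectangle_row_unique[OF host_latin[OF M]] by blast
  qed
  then show ?thesis by (rule card_le_1I)
qed

lemma end_rows_card: "M \<in> hosts \<Longrightarrow> finite {r. (i, r) \<in> chain M ^^ t} \<and> card {r. (i, r) \<in> chain M ^^ t} \<le> 1"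
proof -
  assume M: "M \<in> hosts"
  have "c = d" if "c \<in> {r. (i, r) \<in> chain M ^^ t}" "d \<in> {r. (i, r) \<in> chain M ^^ t}" for c d
    using that level_right_unique[OF M] by blast
  then show ?thesis by (rule card_le_1I)
qed

lemma card_times_le: "finite A \<and> card A \<le> x \<Longrightarrow> finite B \<and> card B \<le> 1 \<Longrightarrow>
  finite (A \<times> B) \<and> card (A \<times> B) \<le> x" for A :: "nat set" and B :: "nat set"
  using mult_le_mono[of "card A" x "card B" 1] by (simp add: card_cartesian_product)

text \<open>
  Moving the continuing \<open>a\<close> out of the column \<open>c\<close> makes the walk end exactly at step \<open>t\<close>. The rows visited so far
  are untouched, so the switched rectangle still shows the column \<open>c\<close> as the end of its chain.
\<close>

lemma cut_chain:
  assumes L: "L \<in> hosts" and r: "(i, r) \<in> chain L ^^ t" and b: "L (r, c) = Some b" and q: "L (q, c) = Some a"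
    and free: "P (q, c) = None" and qi: "q \<noteq> i"
    and unvisited: "\<And>u. u \<le> t \<Longrightarrow> (i, q) \<notin> chain L ^^ u"
    and c': "c' \<in> switchable n L q c - protected q"
  shows "swap_cells L q c c' \<in> long_chain t - long_chain (Suc t)" "c \<in> end_cols t (swap_cells L q c c')"
proof -
  let ?M = "swap_cells L q c c'"
  have M: "?M \<in> hosts" using swap_in_host[OF L q c' free] qi by simp
  have rM: "(i, r) \<in> chain ?M ^^ t" by (rule chain_swap_unvisited[OF L r unvisited])
  have "r \<noteq> q" using unvisited[of t] r by auto
  then have bM: "?M (r, c) = Some b" using b by (simp add: swap_cells_other_row)
  show "c \<in> end_cols t ?M" using rM bM by (auto simp: end_cols_def)
  have "?M \<notin> long_chain (Suc t)"
  proof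
    assume "?M \<in> long_chain (Suc t)"
    then obtain r' z where "(i, r') \<in> chain ?M ^^ t" "(r', z) \<in> chain ?M" by (auto simp: long_chain_def)
    moreover from this have "r' = r" using level_right_unique[OF M] rM by blast
    ultimately obtain d where d: "?M (r, d) = Some b" "?M (z, d) = Some a"
      by (auto simp: chain_def link_def)
    have dc: "d = c" using latin_rectangle_row_unique[OF host_latin[OF M] d(1) bM] .
    show False
    proof (cases "z = q")
      case True
      then have "L (q, c') = Some a" using d(2) dc swap_cells_apply(1)[of c' n L q c] c' by auto
      then have "c' = c" using latin_rectangle_row_unique[OF host_latin[OF L]] q by blast
      then show False using swap_cells_apply(3)[of c' n L q c] c' by auto
    next
      case False
      then have "L (z, c) = Some a" using d(2) dc by (simp add: swap_cells_other_row)
      then show False using latin_rectangle_col_unique[OF host_latin[OF L]] q False by blast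
    qed
  qed
  then show "?M \<in> long_chain t - long_chain (Suc t)" using M rM by (auto simp: long_chain_def)
qed

text \<open>
  To undo \<open>cut_chain\<close> it suffices to choose the row of the moved \<open>a\<close>: its column is the end of the chain.
\<close>

lemma long_chain_step: "(n - 2 * k - Suc f) * card (long_chain (Suc t)) \<le> k * card (long_chain t - long_chain (Suc t))"
proof (rule switching_bound[where x = a and W = "\<lambda>M. {1..k} \<times> end_cols t M"])
  show "long_chain (Suc t) \<subseteq> latin_rectangles k n" "long_chain t - long_chain (Suc t) \<subseteq> latin_rectangles k n"
    using long_chain_subset host_latin by blast+
  show "finite ({1..k} \<times> end_cols t M) \<and> card ({1..k} \<times> end_cols t M) \<le> k" if "M \<in> long_chain t - long_chain (Suc t)" for M
    using that long_chain_subset by (intro card_times_le end_cols_card) auto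
  show "\<exists>r c F. L (r, c) = Some a \<and> finite F \<and> card F \<le> Suc f \<and>
      (\<forall>c' \<in> switchable n L r c - F. swap_cells L r c c' \<in> long_chain t - long_chain (Suc t) \<and>
        (r, c) \<in> {1..k} \<times> end_cols t (swap_cells L r c c'))" if LG: "L \<in> long_chain (Suc t)" for L
  proof -
    have L: "L \<in> hosts" using LG long_chain_subset by blast
    obtain r q where r: "(i, r) \<in> chain L ^^ t" and rq: "(r, q) \<in> chain L" and qt: "(i, q) \<in> chain L ^^ Suc t"
      using LG by (auto simp: long_chain_def)
    obtain c where b: "L (r, c) = Some b" and q: "L (q, c) = Some a" and qb: "q \<notin> bad_rows" "q \<noteq> i"
      using rq by (auto simp: chain_def link_def)
    have qk: "q \<in> {1..k}" using latin_rectangle_cellD(1)[OF host_latin[OF L] q] .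
    have free: "P (q, c) = None"
    proof (rule ccontr)
      assume "P (q, c) \<noteq> None"
      then obtain z where "P (q, c) = Some z" by blast
      moreover from this have "z = a" using host_extends[OF L] q by fastforce
      ultimately show False using qb(1) by (auto simp: bad_rows_def)
    qed
    have unv: "(i, q) \<notin> chain L ^^ u" if "u \<le> t" for u
      using level_unique[OF L qt, of u] that by auto
    show ?thesis
      using cut_chain[OF L r b q free qb(2) unv] protected_card[OF qk] q qk by blast
  qed
qed

lemma hits_row_bound: "(n - 2 * k - Suc f) * card (hits_row t) \<le> 2 * f * card (long_chain t)"
proof (rule switching_bound[where x = a and W = "\<lambda>M. bad_rows \<times> end_cols t M"])
  show "hits_row t \<subseteq> latin_rectangles k n" "long_chain t \<subseteq> latin_rectangles k n"
    using hits_row_subset long_chain_subset host_latin by blast+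
  show "finite (bad_rows \<times> end_cols t M) \<and> card (bad_rows \<times> end_cols t M) \<le> 2 * f" if "M \<in> long_chain t" for M
    using that long_chain_subset bad_rows_card by (intro card_times_le end_cols_card) auto
  show "\<exists>r c F. L (r, c) = Some a \<and> finite F \<and> card F \<le> Suc f \<and>
      (\<forall>c' \<in> switchable n L r c - F. swap_cells L r c c' \<in> long_chain t \<and>
        (r, c) \<in> bad_rows \<times> end_cols t (swap_cells L r c c'))" if LH: "L \<in> hits_row t" for L
  proof -
    have L: "L \<in> hosts" using LH hits_row_subset by blast
    obtain r q c where r: "(i, r) \<in> chain L ^^ t" and b: "L (r, c) = Some b" and q: "L (q, c) = Some a"
      and qb: "q \<in> bad_rows" and Pq: "\<And>d. P (q, d) \<noteq> Some a"
      using LH by (auto simp: hits_row_def)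
    have qk: "q \<in> {1..k}" using latin_rectangle_cellD(1)[OF host_latin[OF L] q] .
    have qi: "q \<noteq> i" using qb i_not_bad by blast
    have free: "P (q, c) = None"
      using host_extends[OF L, of q c] q Pq[of c] by (cases "P (q, c)") auto
    \<comment> \<open>Visited rows other than \<open>i\<close> are never bad, so the chain has not been in \<open>q\<close>.\<close>
    have unv: "(i, q) \<notin> chain L ^^ u" if "u \<le> t" for u
      using level_cases qb qi by blast
    show ?thesis
      using cut_chain[OF L r b q free qi unv] protected_card[OF qk] q qb by blast
  qed
qed

text \<open>
  Here the last visited row \<open>r\<close> is changed, by moving its \<open>b\<close>. The chain up to \<open>r\<close> survives because it enters \<open>r\<close>
  through the symbol \<open>a\<close>, which stays in place: column \<open>c\<close> contains \<open>a\<close>, so \<open>a\<close> cannot be the switching partner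
  of \<open>b\<close>. For the way back, the chain itself shows the row, and the column is one in which \<open>P\<close> has \<open>a\<close>.
\<close>

lemma hits_column_bound: "(n - 2 * k - Suc f) * card (hits_column t) \<le> f * card (long_chain t)"
proof (rule switching_bound[where x = b and
      W = "\<lambda>M. prod.swap ` ({c. \<exists>q. P (q, c) = Some a} \<times> {r. (i, r) \<in> chain M ^^ t})"])
  show "hits_column t \<subseteq> latin_rectangles k n" "long_chain t \<subseteq> latin_rectangles k n"
    using hits_column_subset long_chain_subset host_latin by blast+
  show "finite (prod.swap ` ({c. \<exists>q. P (q, c) = Some a} \<times> {r. (i, r) \<in> chain M ^^ t})) \<and>
    card (prod.swap ` ({c. \<exists>q. P (q, c) = Some a} \<times> {r. (i, r) \<in> chain M ^^ t})) \<le> f" if "M \<in> long_chain t" for M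
  proof -
    have "M \<in> hosts" using that long_chain_subset by blast
    from card_times_le[OF _ end_rows_card[OF this], of "{c. \<exists>q. P (q, c) = Some a}" f]
    show ?thesis using bad_cols_card by (simp add: card_image del: product_swap)
  qed
  show "\<exists>r c F. L (r, c) = Some b \<and> finite F \<and> card F \<le> Suc f \<and>
      (\<forall>c' \<in> switchable n L r c - F. swap_cells L r c c' \<in> long_chain t \<and>
        (r, c) \<in> prod.swap ` ({c. \<exists>q. P (q, c) = Some a} \<times> {q. (i, q) \<in> chain (swap_cells L r c c') ^^ t}))"
    if LH: "L \<in> hits_column t" for L
  proof -
    have L: "L \<in> hosts" using LH hits_column_subset by blast
    obtain r q c where r: "(i, r) \<in> chain L ^^ t" and b: "L (r, c) = Some b" and q: "P (q, c) = Some a"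
      using LH by (auto simp: hits_column_def)
    have rk: "r \<in> {1..k}" using latin_rectangle_cellD(1)[OF host_latin[OF L] b] .
    have free: "P (r, c) = None"
    proof (cases "P (r, c)")
      case (Some z)
      then have "P (r, c) = Some b" using host_extends[OF L] b by fastforce
      with level_cases[OF r] row_free(2) show ?thesis by (auto simp: bad_rows_def)
    qed
    \<comment> \<open>The prescribed entry in \<open>(i, j)\<close> is not the one moved, as \<open>P\<close> has no \<open>a\<close> in column \<open>j\<close>.\<close>
    have ne: "(r, c) \<noteq> (i, j)" using q col_free by auto
    have main: "swap_cells L r c c' \<in> long_chain t \<and> (i, r) \<in> chain (swap_cells L r c c') ^^ t"
      if c': "c' \<in> switchable n L r c - protected r" for c'
    proof -
      let ?M = "swap_cells L r c c'"
      have M: "?M \<in> hosts" by (rule swap_in_host[OF L b c' free ne])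
      have La: "L (q, c) = Some a" using host_extends[OF L q] .
      have a_same: "?M (x, d) = Some a \<longleftrightarrow> L (x, d) = Some a" for x d
      proof -
        have "L (r, c) \<noteq> Some a" using b symbols by simp
        moreover have "L (r, c') \<noteq> Some a" using c' La unfolding switchable_def by force
        ultimately show ?thesis by (auto simp: swap_cells_def Transposition.transpose_def)
      qed
      have "(i, r) \<in> chain ?M ^^ t"
      proof (rule relpow_transfer[OF r])
        fix u x y assume u: "u < t" "(i, x) \<in> chain L ^^ u" "(x, y) \<in> chain L" "(i, y) \<in> chain L ^^ Suc u"
        have "x \<noteq> r" using level_unique[OF L r, of u] u by auto
        with u(3) show "(x, y) \<in> chain ?M"
          by (auto simp: chain_def link_def swap_cells_other_row a_same)
      qed
      with M show ?thesis by (auto simp: long_chain_def)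
    qed
    show ?thesis
    proof (intro exI conjI ballI)
      show "L (r, c) = Some b" by (rule b)
      show "finite (protected r)" "card (protected r) \<le> Suc f" using protected_card[OF rk] by auto
      fix c' assume c': "c' \<in> switchable n L r c - protected r"
      from main[OF this] show "swap_cells L r c c' \<in> long_chain t" by blast
      from main[OF c'] q show "(r, c) \<in> prod.swap ` ({c. \<exists>q. P (q, c) = Some a} \<times>
          {q. (i, q) \<in> chain (swap_cells L r c c') ^^ t})"
        by force
    qed
  qed
qed

end

context two_symbol_chain
begin

abbreviation switches :: nat where "switches \<equiv> n - 2 * k - Suc f"

lemma hosts_eq: "hosts = completions k n (P((i, j) \<mapsto> s))"
  using cell_empty unfolding hosts_def completions_def map_le_def by (auto split: if_splits)

text \<open>
  The bounds of \<open>long_chain_step\<close> telescope: every rectangle ends its chain at most once.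
\<close>

lemma long_chain_sum: "switches * (\<Sum>t<N. card (long_chain (Suc t))) + k * card (long_chain N) \<le> k * card hosts"
proof (induction N)
  case 0
  show ?case using card_mono[OF finite_hosts long_chain_subset[of 0]] by simp
next
  case (Suc N)
  have "long_chain (Suc N) \<subseteq> long_chain N" by (auto simp: long_chain_def)
  then have "card (long_chain N - long_chain (Suc N)) + card (long_chain (Suc N)) = card (long_chain N)"
    using finite_subset[OF long_chain_subset finite_hosts] by (metis Nat.add_diff_assoc2 card_Diff_subset card_mono le_add_diff_inverse2)
  then have "k * card (long_chain N - long_chain (Suc N)) + k * card (long_chain (Suc N)) = k * card (long_chain N)"
    by (metis distrib_left)
  with Suc.IH long_chain_step[of N] show ?case by (simp add: distrib_left)
qed

lemma hits_sum: "switches * switches * (\<Sum>t<N. card (hits_column t) + card (hits_row t)) \<le> 3 * f * (switches + k) * card hosts"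
proof -
  let ?g = "\<Sum>t<N. card (long_chain t)"
  have "switches * (\<Sum>t<N. card (hits_column t) + card (hits_row t)) = (\<Sum>t<N. switches * card (hits_column t) + switches * card (hits_row t))"
    by (simp add: sum_distrib_left distrib_left)
  also have "\<dots> \<le> (\<Sum>t<N. f * card (long_chain t) + 2 * f * card (long_chain t))"
    by (intro sum_mono add_mono hits_column_bound hits_row_bound)
  also have "\<dots> = 3 * f * ?g" by (simp add: sum_distrib_left mult.assoc)
  finally have H: "switches * (\<Sum>t<N. card (hits_column t) + card (hits_row t)) \<le> 3 * f * ?g" .
  have "?g \<le> (\<Sum>t<Suc N. card (long_chain t))" by simp
  also have "\<dots> = card (long_chain 0) + (\<Sum>t<N. card (long_chain (Suc t)))" by (rule sum.lessThan_Suc_shift)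
  finally have "switches * ?g \<le> switches * card (long_chain 0) + switches * (\<Sum>t<N. card (long_chain (Suc t)))"
    by (metis distrib_left mult_le_mono2)
  also have "\<dots> \<le> switches * card hosts + k * card hosts"
    using long_chain_sum[of N] card_mono[OF finite_hosts long_chain_subset[of 0]] by (intro add_mono mult_le_mono2) auto
  finally have g: "switches * ?g \<le> (switches + k) * card hosts" by (simp add: distrib_right)
  have "switches * (switches * (\<Sum>t<N. card (hits_column t) + card (hits_row t))) \<le> switches * (3 * f * ?g)" using H by (rule mult_le_mono2)
  also have "\<dots> = 3 * f * (switches * ?g)" by (simp only: ac_simps)
  also have "\<dots> \<le> 3 * f * ((switches + k) * card hosts)" using g by (rule mult_le_mono2)
  finally show ?thesis by (simp only: mult.assoc)
qed

text \<open>
  As long as the walk has not run into a bad row, all its rows lie on the chain: when it closes up at \<open>i\<close>, it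
  only repeats itself. Bad rows do not lie on the chain.
\<close>

lemma reach_bad_row:
  assumes L: "L \<in> hosts" and reach: "(i, q) \<in> (link a b L)\<^sup>*" and q: "q \<in> bad_rows"
  shows "\<exists>t. L \<in> hits_column t \<union> hits_row t"
proof (rule ccontr)
  assume no: "\<nexists>t. L \<in> hits_column t \<union> hits_row t"
  have "\<exists>t. (i, q) \<in> chain L ^^ t"
    using reach
  proof (induction rule: rtrancl_induct)
    case base
    show ?case by (rule exI[of _ 0]) simp
  next
    case (step y z)
    then obtain t where t: "(i, y) \<in> chain L ^^ t" by blast
    obtain c where c: "L (y, c) = Some b" "L (z, c) = Some a" using step(2) by (auto simp: link_def)
    have "z \<notin> bad_rows"
    proof
      assume z: "z \<in> bad_rows"
      show False
      proof (cases "\<exists>d. P (z, d) = Some a")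
        case True
        then obtain d where d: "P (z, d) = Some a" by blast
        have "d = c" using latin_rectangle_row_unique[OF host_latin[OF L] host_extends[OF L d] c(2)] .
        then have "L \<in> hits_column t" using t c(1) d L by (auto simp: hits_column_def)
        with no show False by blast
      next
        case False
        then have "L \<in> hits_row t" using t c z L unfolding hits_row_def by blast
        with no show False by blast
      qed
    qed
    show ?case
    proof (cases "z = i")
      case True
      then show ?thesis by (intro exI[of _ 0]) simp
    next
      case False
      with step(2) \<open>z \<notin> bad_rows\<close> have "(y, z) \<in> chain L" by (auto simp: chain_def)
      with t have "(i, z) \<in> chain L ^^ Suc t" by auto
      then show ?thesis by blast
    qed
  qed
  then obtain t where "(i, q) \<in> chain L ^^ t" by blast
  from level_cases[OF this] q i_not_bad show False by blast
qed

text \<open>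
  Each rectangle is charged to one step \<open>t\<close> at which its walk meets a bad row. Finitely many rectangles need only
  finitely many steps, and \<open>hits_sum\<close> bounds the sum over them independently of their number.
\<close>

lemma reach_bound:
  "switches * switches * card {L \<in> completions k n (P((i, j) \<mapsto> s)).
       \<exists>q c. (P (q, c) = Some a \<or> P (q, c) = Some b) \<and> (i, q) \<in> (link a b L)\<^sup>*}
     \<le> 3 * f * (switches + k) * card (completions k n (P((i, j) \<mapsto> s)))"
proof -
  let ?U = "{L \<in> hosts. \<exists>q c. (P (q, c) = Some a \<or> P (q, c) = Some b) \<and> (i, q) \<in> (link a b L)\<^sup>*}"
  have "\<forall>L\<in>?U. \<exists>t. L \<in> hits_column t \<union> hits_row t"
  proof
    fix L assume "L \<in> ?U"
    then obtain q where "L \<in> hosts" "(i, q) \<in> (link a b L)\<^sup>*" "q \<in> bad_rows" by (auto simp: bad_rows_def)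
    then show "\<exists>t. L \<in> hits_column t \<union> hits_row t" by (rule reach_bad_row)
  qed
  then obtain \<tau> where \<tau>: "\<forall>L\<in>?U. L \<in> hits_column (\<tau> L) \<union> hits_row (\<tau> L)" by (rule bchoice[THEN exE])
  have finU: "finite ?U" using finite_hosts by simp
  then obtain N where N: "\<forall>L\<in>?U. \<tau> L < N"
    using finite_nat_set_iff_bounded[of "\<tau> ` ?U"] by auto
  have "?U \<subseteq> (\<Union>t<N. hits_column t \<union> hits_row t)" using \<tau> N by blast
  moreover have fin: "finite (hits_column t)" "finite (hits_row t)" for t
    using finite_subset[OF hits_column_subset finite_hosts] finite_subset[OF hits_row_subset finite_hosts] by auto
  ultimately have "card ?U \<le> card (\<Union>t<N. hits_column t \<union> hits_row t)" by (intro card_mono) auto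
  also have "\<dots> \<le> (\<Sum>t<N. card (hits_column t \<union> hits_row t))" by (rule card_UN_le) simp
  also have "\<dots> \<le> (\<Sum>t<N. card (hits_column t) + card (hits_row t))" by (intro sum_mono card_Un_le)
  finally have "switches * switches * card ?U \<le> switches * switches * (\<Sum>t<N. card (hits_column t) + card (hits_row t))" by (rule mult_le_mono2)
  with hits_sum[of N] show ?thesis unfolding hosts_eq by linarith
qed

end

section \<open>Kempe changes\<close>

definition touching :: "nat \<Rightarrow> nat \<Rightarrow> array \<Rightarrow> (nat \<times> nat) set" where
  "touching a b L = link a b L \<union> link b a L"

definition component :: "nat \<Rightarrow> nat \<Rightarrow> nat \<Rightarrow> array \<Rightarrow> nat set" where
  "component a b i L = {r. (i, r) \<in> (touching a b L)\<^sup>*}"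

definition kempe_change :: "nat \<Rightarrow> nat \<Rightarrow> nat \<Rightarrow> array \<Rightarrow> array" where
  "kempe_change a b i L = (\<lambda>(r, c). if r \<in> component a b i L
     then map_option (Transposition.transpose a b) (L (r, c)) else L (r, c))"

lemma component_start: "i \<in> component a b i L"
  by (simp add: component_def)

lemma component_closed:
  assumes rq: "(r, q) \<in> touching a b L"
  shows "r \<in> component a b i L \<longleftrightarrow> q \<in> component a b i L"
proof -
  from rq have "(q, r) \<in> touching a b L" by (auto simp: touching_def link_def)
  with rq show ?thesis unfolding component_def mem_Collect_eq by (metis rtrancl.rtrancl_into_rtrancl)
qed

text \<open>
  The two orientations of the walk are inverse partial injections, so a step back along \<open>link b a\<close> after steps
  along \<open>link a b\<close> merely cancels the last of these.
\<close>

lemma component_directed: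
  assumes L: "L \<in> latin_rectangles k n" and "q \<in> component a b i L"
  shows "(i, q) \<in> (link a b L)\<^sup>* \<or> (i, q) \<in> (link b a L)\<^sup>*"
proof -
  have flip: "(i, z) \<in> (link x y L)\<^sup>* \<or> (i, z) \<in> (link y x L)\<^sup>*"
    if "(i, r) \<in> (link x y L)\<^sup>*" "(r, z) \<in> link y x L" for x y r z
    using that(1)
  proof (cases rule: rtranclE)
    case base
    with that(2) show ?thesis by blast
  next
    case (step w)
    have "(z, r) \<in> link x y L" using that(2) by (auto simp: link_def)
    with step(2) have "w = z" using link_left_unique[OF L] by blast
    with step(1) show ?thesis by blast
  qed
  have "(i, q) \<in> (touching a b L)\<^sup>*" using assms(2) by (simp add: component_def)
  then show ?thesis
  proof (induction rule: rtrancl_induct)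
    case base
    show ?case by simp
  next
    case (step r z)
    then consider "(r, z) \<in> link a b L" | "(r, z) \<in> link b a L" by (auto simp: touching_def)
    then show ?case
      using step(3) flip[of r a b z] flip[of r b a z] by cases (blast intro: rtrancl_into_rtrancl)+
  qed
qed

lemma transpose_map_option_eq:
  "map_option (Transposition.transpose a b) v = Some z \<longleftrightarrow> v = Some (Transposition.transpose a b z)"
  by (cases v) (auto simp: transpose_eq_iff)

lemma kempe_change_inside:
  "r \<in> component a b i L \<Longrightarrow> kempe_change a b i L (r, c) = Some z \<longleftrightarrow> L (r, c) = Some (Transposition.transpose a b z)"
  by (simp add: kempe_change_def transpose_map_option_eq del: map_option_eq_Some)

lemma kempe_change_outside:
  "r \<notin> component a b i L \<Longrightarrow> kempe_change a b i L (r, c) = L (r, c)"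
  by (simp add: kempe_change_def)

text \<open>
  Inside the component and outside it columns stay injective. A clash between a changed and an unchanged row could
  only come from \<open>a\<close> and \<open>b\<close> in one column, but then the two rows touch and lie on the same side.
\<close>

lemma kempe_change_latin:
  assumes L: "L \<in> latin_rectangles k n" and ab: "a \<in> {1..n}" "b \<in> {1..n}"
  shows "kempe_change a b i L \<in> latin_rectangles k n"
proof (rule latin_rectangleI)
  let ?K = "kempe_change a b i L" and ?T = "component a b i L" and ?t = "Transposition.transpose a b"
  note row = latin_rectangle_row_unique[OF L] and col = latin_rectangle_col_unique[OF L]
  have dom: "dom ?K = dom L" by (auto simp: kempe_change_def dom_def split: if_splits)
  then show "dom ?K = {1..k} \<times> {1..n}" using L by (simp add: latin_rectangles_def)
  show "ran ?K \<subseteq> {1..n}"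
  proof
    fix z assume "z \<in> ran ?K"
    then obtain r c where K: "?K (r, c) = Some z" by (auto simp: ran_def)
    show "z \<in> {1..n}"
    proof (cases "r \<in> ?T")
      case True
      then have "?t z \<in> {1..n}" using K kempe_change_inside latin_rectangle_cellD(3)[OF L] by blast
      then show ?thesis using ab by (auto simp: Transposition.transpose_def split: if_splits)
    next
      case False
      then show ?thesis using K kempe_change_outside latin_rectangle_cellD(3)[OF L] by metis
    qed
  qed
  show "c = c'" if "?K (r, c) = Some z" "?K (r, c') = Some z" for r c c' z
  proof (cases "r \<in> ?T")
    case True
    with that row show ?thesis by (simp add: kempe_change_inside)
  next
    case False
    with that row show ?thesis by (simp add: kempe_change_outside)
  qed
  have mixed: False if r: "r \<in> ?T" "q \<notin> ?T" and K: "?K (r, c) = Some z" "?K (q, c) = Some z" for r q c z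
  proof -
    have eq: "L (r, c) = Some (?t z)" "L (q, c) = Some z"
      using r K by (simp_all add: kempe_change_inside kempe_change_outside)
    show False
    proof (cases "z = a \<or> z = b")
      case True
      with eq have "(r, q) \<in> touching a b L" by (auto simp: touching_def link_def)
      with r component_closed show False by blast
    next
      case False
      with eq col r show False by (metis transpose_apply_other)
    qed
  qed
  show "r = q" if K: "?K (r, c) = Some z" "?K (q, c) = Some z" for r q c z
  proof -
    consider "r \<in> ?T" "q \<in> ?T" | "r \<notin> ?T" "q \<notin> ?T"
      using mixed[OF _ _ K] mixed[OF _ _ K(2,1)] by blast
    then show ?thesis using K col by cases (simp_all add: kempe_change_inside kempe_change_outside)
  qed
qed

text \<open>
  Touching is symmetric in \<open>a\<close> and \<open>b\<close>, so it is kept among rows on the same side of the component. Rows on different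
  sides do not touch before the change, as the component is closed; if they touched after it, one symbol would have
  occurred before in both of them in the same column.
\<close>

lemma touching_kempe_change:
  assumes L: "L \<in> latin_rectangles k n"
  shows "touching a b (kempe_change a b i L) = touching a b L"
proof -
  let ?K = "kempe_change a b i L" and ?T = "component a b i L"
  have split: "r \<in> ?T \<longleftrightarrow> q \<in> ?T" if rq: "?K (r, c) = Some x" "?K (q, c) = Some y"
    and xy: "x = a \<and> y = b \<or> x = b \<and> y = a" for r q c x y
  proof (rule ccontr)
    assume "(r \<in> ?T) \<noteq> (q \<in> ?T)"
    then consider "r \<in> ?T" "q \<notin> ?T" | "r \<notin> ?T" "q \<in> ?T" by blast
    then have "L (r, c) = L (q, c) \<and> L (r, c) \<noteq> None"
      using rq xy by cases (auto simp: kempe_change_inside kempe_change_outside)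
    then have "r = q" using latin_rectangle_col_unique[OF L] by (metis option.exhaust)
    with \<open>(r \<in> ?T) \<noteq> (q \<in> ?T)\<close> show False by simp
  qed
  have "(r, q) \<in> touching a b ?K \<longleftrightarrow> (r, q) \<in> touching a b L" for r q
  proof (cases "(r \<in> ?T) = (q \<in> ?T)")
    case True
    then show ?thesis
      by (cases "r \<in> ?T") (auto simp: touching_def link_def kempe_change_inside kempe_change_outside)
  next
    case False
    then have "(r, q) \<notin> touching a b L" using component_closed by blast
    moreover have "(r, q) \<notin> touching a b ?K"
      using False split unfolding touching_def link_def by blast
    ultimately show ?thesis by blast
  qed
  then show ?thesis by auto
qed

lemma kempe_change_involution:
  assumes L: "L \<in> latin_rectangles k n"
  shows "kempe_change a b i (kempe_change a b i L) = L"
proof -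
  have T: "component a b i (kempe_change a b i L) = component a b i L"
    by (simp add: component_def touching_kempe_change[OF L])
  have "map_option (Transposition.transpose a b) (map_option (Transposition.transpose a b) v) = v" for v
    by (cases v) simp_all
  then show ?thesis
    unfolding kempe_change_def[of a b i "kempe_change a b i L"] T
    by (auto simp: kempe_change_def)
qed

lemma kempe_change_completion:
  assumes L: "L \<in> completions k n (P((i, j) \<mapsto> a))" and ab: "a \<in> {1..n}" "b \<in> {1..n}"
    and empty: "P (i, j) = None"
    and avoid: "\<And>q c. P (q, c) = Some a \<or> P (q, c) = Some b \<Longrightarrow> q \<notin> component a b i L"
  shows "kempe_change a b i L \<in> completions k n (P((i, j) \<mapsto> b))"
proof -
  let ?K = "kempe_change a b i L"
  have latin: "L \<in> latin_rectangles k n" and ext: "P((i, j) \<mapsto> a) \<subseteq>\<^sub>m L"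
    using L by (auto simp: completions_def)
  have Lext: "L (r, c) = Some z" if "(P((i, j) \<mapsto> a)) (r, c) = Some z" for r c z
    using ext that unfolding map_le_def by (metis domI)
  have "?K (r, c) = Some z" if z: "(P((i, j) \<mapsto> b)) (r, c) = Some z" for r c z
  proof (cases "(r, c) = (i, j)")
    case True
    with z Lext[of i j a] component_start show ?thesis by (simp add: kempe_change_inside)
  next
    case False
    with z have Pz: "P (r, c) = Some z" by auto
    with False Lext have Lz: "L (r, c) = Some z" by auto
    show ?thesis
    proof (cases "r \<in> component a b i L")
      case True
      with avoid Pz have "z \<noteq> a" "z \<noteq> b" by blast+
      with True Lz show ?thesis by (simp add: kempe_change_inside)
    next
      case False
      with Lz show ?thesis by (simp add: kempe_change_outside)
    qed
  qed
  then have "P((i, j) \<mapsto> b) \<subseteq>\<^sub>m ?K" unfolding map_le_def by (metis domD surj_pair)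
  with kempe_change_latin[OF latin ab] show ?thesis by (simp add: completions_def)
qed

section \<open>The number of completions after adding one entry\<close>

definition candidates :: "nat \<Rightarrow> array \<Rightarrow> nat \<Rightarrow> nat \<Rightarrow> nat set" where
  "candidates n P i j = {x \<in> {1..n}. (\<forall>c. P (i, c) \<noteq> Some x) \<and> (\<forall>r. P (r, j) \<noteq> Some x)}"

locale sparse_array =
  fixes k n f :: nat and P :: array
  assumes dom_P: "dom P \<subseteq> {1..k} \<times> {1..n}"
    and row_sparse: "\<And>r. r \<in> {1..k} \<Longrightarrow> card {c \<in> {1..n}. P (r, c) \<noteq> None} \<le> f"
    and col_sparse: "\<And>c. c \<in> {1..n} \<Longrightarrow> card {r \<in> {1..k}. P (r, c) \<noteq> None} \<le> f"
    and symbol_sparse: "\<And>x. x \<in> {1..n} \<Longrightarrow> card {p \<in> {1..k} \<times> {1..n}. P p = Some x} \<le> f"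
begin

text \<open>
  The excluded symbols are those of \<open>P\<close> in row \<open>i\<close> and in column \<open>j\<close>.
\<close>

lemma card_candidates:
  assumes "i \<in> {1..k}" "j \<in> {1..n}"
  shows "n - 2 * f \<le> card (candidates n P i j)"
proof -
  let ?R = "(\<lambda>c. the (P (i, c))) ` {c \<in> {1..n}. P (i, c) \<noteq> None}"
  let ?C = "(\<lambda>r. the (P (r, j))) ` {r \<in> {1..k}. P (r, j) \<noteq> None}"
  have "card ?R \<le> f"
  proof -
    have "card ?R \<le> card {c \<in> {1..n}. P (i, c) \<noteq> None}" by (rule card_image_le) simp
    also have "\<dots> \<le> f" by (rule row_sparse[OF assms(1)])
    finally show ?thesis .
  qed
  moreover have "card ?C \<le> f"
  proof -
    have "card ?C \<le> card {r \<in> {1..k}. P (r, j) \<noteq> None}" by (rule card_image_le) simp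
    also have "\<dots> \<le> f" by (rule col_sparse[OF assms(2)])
    finally show ?thesis .
  qed
  ultimately have "card (?R \<union> ?C) \<le> 2 * f" using card_Un_le[of ?R ?C] by linarith
  moreover have "card {1..n} - card (?R \<union> ?C) \<le> card ({1..n} - (?R \<union> ?C))"
    by (rule diff_card_le_card_Diff) simp
  moreover have "{1..n} - (?R \<union> ?C) \<subseteq> candidates n P i j"
  proof
    fix x assume x: "x \<in> {1..n} - (?R \<union> ?C)"
    have "P (i, c) \<noteq> Some x" for c
    proof
      assume c: "P (i, c) = Some x"
      then have "(i, c) \<in> dom P" by blast
      then have "c \<in> {1..n}" using dom_P by blast
      with c have "x \<in> ?R" by force
      with x show False by blast
    qed
    moreover have "P (r, j) \<noteq> Some x" for r
    proof
      assume r: "P (r, j) = Some x"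
      then have "(r, j) \<in> dom P" by blast
      then have "r \<in> {1..k}" using dom_P by blast
      with r have "x \<in> ?C" by force
      with x show False by blast
    qed
    ultimately show "x \<in> candidates n P i j" using x by (auto simp: candidates_def)
  qed
  then have "card ({1..n} - (?R \<union> ?C)) \<le> card (candidates n P i j)"
    by (rule card_mono[rotated]) (simp add: candidates_def)
  ultimately show ?thesis by simp
qed

lemma completions_split:
  assumes "i \<in> {1..k}" "j \<in> {1..n}" "P (i, j) = None"
  shows "card (completions k n P) = (\<Sum>x\<in>candidates n P i j. card (completions k n (P((i, j) \<mapsto> x))))"
proof -
  have "completions k n P = (\<Union>x\<in>candidates n P i j. completions k n (P((i, j) \<mapsto> x)))"
  proof (intro equalityI subsetI)
    fix L assume "L \<in> completions k n P"
    then have L: "L \<in> latin_rectangles k n" and ext: "P \<subseteq>\<^sub>m L" by (auto simp: completions_def)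
    obtain x where x: "L (i, j) = Some x" "x \<in> {1..n}" using latin_rectangle_filled[OF L assms(1,2)] .
    have Lext: "L p = Some y" if "P p = Some y" for p y
      using ext that unfolding map_le_def by (metis domI)
    have "P (i, c) \<noteq> Some x" for c
      using latin_rectangle_row_unique[OF L x(1)] Lext[of "(i, c)" x] assms(3) by fastforce
    moreover have "P (r, j) \<noteq> Some x" for r
      using latin_rectangle_col_unique[OF L x(1)] Lext[of "(r, j)" x] assms(3) by fastforce
    ultimately have "x \<in> candidates n P i j" using x(2) by (simp add: candidates_def)
    moreover have "P((i, j) \<mapsto> x) \<subseteq>\<^sub>m L" using Lext x(1) by (auto simp: map_le_def)
    ultimately show "L \<in> (\<Union>x\<in>candidates n P i j. completions k n (P((i, j) \<mapsto> x)))"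
      using L by (auto simp: completions_def)
  next
    fix L assume "L \<in> (\<Union>x\<in>candidates n P i j. completions k n (P((i, j) \<mapsto> x)))"
    then obtain x where L: "L \<in> latin_rectangles k n" and ext: "P((i, j) \<mapsto> x) \<subseteq>\<^sub>m L"
      by (auto simp: completions_def)
    have "P \<subseteq>\<^sub>m P((i, j) \<mapsto> x)" using assms(3) by (auto simp: map_le_def)
    then have "P \<subseteq>\<^sub>m L" using ext map_le_trans by blast
    with L show "L \<in> completions k n P" by (simp add: completions_def)
  qed
  moreover have "completions k n (P((i, j) \<mapsto> x)) \<inter> completions k n (P((i, j) \<mapsto> y)) = {}" if "x \<noteq> y" for x y
    using that by (auto simp: completions_def map_le_def) (metis option.inject)
  moreover have "finite (candidates n P i j)" by (simp add: candidates_def)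
  ultimately show ?thesis using finite_completions by (simp add: card_UN_disjoint)
qed

text \<open>
  The Kempe change injects the rectangles with \<open>a\<close> in \<open>(i, j)\<close> whose component avoids the bad rows into those
  with \<open>b\<close> there; the others are counted by \<open>reach_bound\<close>, once for each direction of the walk.
\<close>

lemma completions_comparison:
  fixes D :: nat
  defines "D \<equiv> n - 2 * k - Suc f"
  assumes cell: "i \<in> {1..k}" "j \<in> {1..n}" "P (i, j) = None"
    and a: "a \<in> candidates n P i j" and b: "b \<in> candidates n P i j"
  shows "D * D * card (completions k n (P((i, j) \<mapsto> a)))
    \<le> D * D * card (completions k n (P((i, j) \<mapsto> b)))
      + 6 * f * (D + k) * card (completions k n (P((i, j) \<mapsto> a)))"
proof (cases "a = b")
  case False
  let ?Xa = "completions k n (P((i, j) \<mapsto> a))" and ?Xb = "completions k n (P((i, j) \<mapsto> b))"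
  have ab: "a \<in> {1..n}" "b \<in> {1..n}" "\<And>c. P (i, c) \<noteq> Some a" "\<And>c. P (i, c) \<noteq> Some b"
    "\<And>r. P (r, j) \<noteq> Some a" "\<And>r. P (r, j) \<noteq> Some b"
    using a b by (auto simp: candidates_def)
  define U where "U x y = {L \<in> ?Xa. \<exists>q c. (P (q, c) = Some x \<or> P (q, c) = Some y) \<and> (i, q) \<in> (link x y L)\<^sup>*}"
    for x y
  interpret ab: two_symbol_chain k n f P i j a b a
    by standard (use False ab cell dom_P row_sparse symbol_sparse in auto)
  interpret ba: two_symbol_chain k n f P i j b a a
    by standard (use False ab cell dom_P row_sparse symbol_sparse in auto)
  have U: "D * D * card (U a b) \<le> 3 * f * (D + k) * card ?Xa" "D * D * card (U b a) \<le> 3 * f * (D + k) * card ?Xa"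
    unfolding U_def D_def by (rule ab.reach_bound ba.reach_bound)+
  let ?Y = "?Xa - (U a b \<union> U b a)"
  have Y: "L \<in> latin_rectangles k n" "kempe_change a b i L \<in> ?Xb" if "L \<in> ?Y" for L
  proof -
    show latin: "L \<in> latin_rectangles k n" using that by (simp add: completions_def)
    have "q \<notin> component a b i L" if "P (q, c) = Some a \<or> P (q, c) = Some b" for q c
      using component_directed[OF latin, of q a b i] that \<open>L \<in> ?Y\<close> unfolding U_def by blast
    moreover have "L \<in> ?Xa" using that by blast
    ultimately show "kempe_change a b i L \<in> ?Xb"
      using kempe_change_completion[where P = P and i = i and j = j, OF _ ab(1,2) cell(3)] by blast
  qed
  have "inj_on (kempe_change a b i) ?Y"
    by (rule inj_onI) (metis Y(1) kempe_change_involution)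
  then have "card ?Y \<le> card ?Xb"
    using Y(2) by (intro card_inj_on_le[OF _ _ finite_completions]) auto
  moreover have "card ?Xa - card (U a b \<union> U b a) \<le> card ?Y"
    by (rule diff_card_le_card_Diff) (auto simp: U_def finite_completions)
  ultimately have "card ?Xa \<le> card ?Xb + (card (U a b) + card (U b a))"
    using card_Un_le[of "U a b" "U b a"] by linarith
  then have "D * D * card ?Xa \<le> D * D * (card ?Xb + (card (U a b) + card (U b a)))" by (rule mult_le_mono2)
  also have "\<dots> = D * D * card ?Xb + D * D * card (U a b) + D * D * card (U b a)"
    by (simp only: distrib_left add.assoc)
  also have "\<dots> \<le> D * D * card ?Xb + 6 * f * (D + k) * card ?Xa" using U by linarith
  finally show ?thesis .
qed simp

text \<open>
  All summands \<open>N x\<close> of \<open>N(P)\<close> agree up to the factor \<open>1 - \<delta>\<close>, and their number lies between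
  \<open>(1 - \<delta>) n\<close> and \<open>n\<close>. Hence \<open>(1 - \<delta>) N(P) \<le> n N(a)\<close> and \<open>(1 - \<delta>)\<^sup>2 n N(a) \<le> N(P)\<close>. The choice
  \<open>\<delta> = \<epsilon> / 4\<close> makes \<open>(1 + \<epsilon>) (1 - \<delta>)\<^sup>2 \<ge> (1 + \<epsilon>) (1 - \<epsilon> / 2) \<ge> 1\<close>.
\<close>

lemma completions_ratio:
  fixes \<epsilon> \<delta> :: real
  assumes cell: "i \<in> {1..k}" "j \<in> {1..n}" "P (i, j) = None" and a: "a \<in> candidates n P i j"
    and \<epsilon>: "0 < \<epsilon>" "\<epsilon> < 1" and \<delta>: "\<delta> = \<epsilon> / 4"
    and D: "0 < n - 2 * k - Suc f"
    and small: "6 * real f * (real (n - 2 * k - Suc f) + real k) \<le> \<delta> * (real (n - 2 * k - Suc f))\<^sup>2"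
    and f: "2 * real f \<le> \<delta> * real n"
  shows "(1 - \<epsilon>) / real n * real (card (completions k n P)) \<le> real (card (completions k n (P((i, j) \<mapsto> a))))"
    "real (card (completions k n (P((i, j) \<mapsto> a)))) \<le> (1 + \<epsilon>) / real n * real (card (completions k n P))"
proof -
  define N where "N x = real (card (completions k n (P((i, j) \<mapsto> x))))" for x
  let ?S = "candidates n P i j" and ?D = "n - 2 * k - Suc f"
  have n: "0 < real n" using cell(2) by simp
  have cmp: "(1 - \<delta>) * N x \<le> N y" if "x \<in> ?S" "y \<in> ?S" for x y
  proof -
    have "real (?D * ?D * card (completions k n (P((i, j) \<mapsto> x))))
      \<le> real (?D * ?D * card (completions k n (P((i, j) \<mapsto> y)))
        + 6 * f * (?D + k) * card (completions k n (P((i, j) \<mapsto> x))))"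
      using completions_comparison[OF cell that] by (rule of_nat_mono)
    then have "(real ?D)\<^sup>2 * N x \<le> (real ?D)\<^sup>2 * N y + (6 * real f * (real ?D + real k)) * N x"
      by (simp add: N_def power2_eq_square)
    also have "\<dots> \<le> (real ?D)\<^sup>2 * N y + (\<delta> * (real ?D)\<^sup>2) * N x"
      using small by (intro add_left_mono mult_right_mono) (auto simp: N_def)
    finally have "(real ?D)\<^sup>2 * ((1 - \<delta>) * N x) \<le> (real ?D)\<^sup>2 * N y" by (simp add: algebra_simps)
    then show ?thesis using D by simp
  qed
  have total: "real (card (completions k n P)) = (\<Sum>x\<in>?S. N x)"
    using completions_split[OF cell] by (simp add: N_def)
  have Na: "0 \<le> N a" by (simp add: N_def)
  have "?S \<subseteq> {1..n}" by (auto simp: candidates_def)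
  from card_mono[OF _ this] have S_le: "real (card ?S) \<le> real n" by simp
  have S_ge: "(1 - \<delta>) * real n \<le> real (card ?S)"
    using card_candidates[OF cell(1,2)] f by (simp add: algebra_simps)
  have "(1 - \<delta>) * (\<Sum>x\<in>?S. N x) = (\<Sum>x\<in>?S. (1 - \<delta>) * N x)" by (simp add: sum_distrib_left)
  also have "\<dots> \<le> (\<Sum>x\<in>?S. N a)" by (rule sum_mono) (rule cmp[OF _ a])
  also have "\<dots> \<le> real n * N a" using S_le Na by (simp add: mult_right_mono)
  finally have up: "(1 - \<delta>) * (\<Sum>x\<in>?S. N x) \<le> real n * N a" .
  have "(1 - \<epsilon>) * (\<Sum>x\<in>?S. N x) \<le> (1 - \<delta>) * (\<Sum>x\<in>?S. N x)"
    using \<epsilon> \<delta> by (intro mult_right_mono sum_nonneg) (auto simp: N_def)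
  with up have "(1 - \<epsilon>) * (\<Sum>x\<in>?S. N x) \<le> real n * N a" by linarith
  then show "(1 - \<epsilon>) / real n * real (card (completions k n P)) \<le> real (card (completions k n (P((i, j) \<mapsto> a))))"
    using n total by (simp add: N_def field_simps)
  have "(1 - \<delta>) * real n * ((1 - \<delta>) * N a) \<le> real (card ?S) * ((1 - \<delta>) * N a)"
    using S_ge Na \<epsilon> \<delta> by (intro mult_right_mono) auto
  also have "\<dots> = (\<Sum>x\<in>?S. (1 - \<delta>) * N a)" by simp
  also have "\<dots> \<le> (\<Sum>x\<in>?S. N x)" by (rule sum_mono) (rule cmp[OF a])
  finally have low: "(1 - \<delta>)\<^sup>2 * (real n * N a) \<le> (\<Sum>x\<in>?S. N x)" by (simp add: power2_eq_square mult_ac)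
  have "1 \<le> (1 + \<epsilon>) * (1 - \<delta>)\<^sup>2"
  proof -
    have "(1 - \<delta>)\<^sup>2 = 1 - 2 * \<delta> + \<delta>\<^sup>2" by (simp add: power2_diff)
    then have "(1 - \<delta>)\<^sup>2 \<ge> 1 - \<epsilon> / 2" using \<delta> zero_le_power2[of \<delta>] by linarith
    then have "(1 + \<epsilon>) * (1 - \<delta>)\<^sup>2 \<ge> (1 + \<epsilon>) * (1 - \<epsilon> / 2)" using \<epsilon> by (intro mult_left_mono) auto
    moreover have "(1 + \<epsilon>) * (1 - \<epsilon> / 2) = 1 + \<epsilon> * (1 - \<epsilon>) / 2" by (simp add: field_simps)
    ultimately show ?thesis using \<epsilon> mult_nonneg_nonneg[of \<epsilon> "1 - \<epsilon>"] by linarith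
  qed
  then have "1 * (real n * N a) \<le> ((1 + \<epsilon>) * (1 - \<delta>)\<^sup>2) * (real n * N a)"
    using n Na by (intro mult_right_mono) auto
  also have "\<dots> = (1 + \<epsilon>) * ((1 - \<delta>)\<^sup>2 * (real n * N a))" by (simp only: mult.assoc)
  also have "\<dots> \<le> (1 + \<epsilon>) * (\<Sum>x\<in>?S. N x)" using low \<epsilon> by (intro mult_left_mono) auto
  finally have "real n * N a \<le> (1 + \<epsilon>) * (\<Sum>x\<in>?S. N x)" by simp
  then show "real (card (completions k n (P((i, j) \<mapsto> a)))) \<le> (1 + \<epsilon>) / real n * real (card (completions k n P))"
    using n total by (simp add: N_def field_simps)
qed

end

section \<open>Adding all entries\<close>

lemma sparse_array_mono:
  assumes "sparse_array k n f P" "P' \<subseteq>\<^sub>m P"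
  shows "sparse_array k n f P'"
proof -
  interpret sparse_array k n f P by fact
  have sub: "P p = Some x" if "P' p = Some x" for p x
    using assms(2) that unfolding map_le_def by (metis domI)
  have sub_dom: "P p \<noteq> None" if "P' p \<noteq> None" for p
    using sub that by (metis not_None_eq)
  show ?thesis
  proof
    show "dom P' \<subseteq> {1..k} \<times> {1..n}" using dom_P map_le_implies_dom_le[OF assms(2)] by blast
    show "card {c \<in> {1..n}. P' (r, c) \<noteq> None} \<le> f" if "r \<in> {1..k}" for r
    proof -
      have "{c \<in> {1..n}. P' (r, c) \<noteq> None} \<subseteq> {c \<in> {1..n}. P (r, c) \<noteq> None}" using sub_dom by blast
      then show ?thesis by (intro order.trans[OF card_mono row_sparse[OF that]]) simp_all
    qed
    show "card {r \<in> {1..k}. P' (r, c) \<noteq> None} \<le> f" if "c \<in> {1..n}" for c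
    proof -
      have "{r \<in> {1..k}. P' (r, c) \<noteq> None} \<subseteq> {r \<in> {1..k}. P (r, c) \<noteq> None}" using sub_dom by blast
      then show ?thesis by (intro order.trans[OF card_mono col_sparse[OF that]]) simp_all
    qed
    show "card {p \<in> {1..k} \<times> {1..n}. P' p = Some x} \<le> f" if "x \<in> {1..n}" for x
    proof -
      have "{p \<in> {1..k} \<times> {1..n}. P' p = Some x} \<subseteq> {p \<in> {1..k} \<times> {1..n}. P p = Some x}" using sub by blast
      then show ?thesis by (intro order.trans[OF card_mono symbol_sparse[OF that]]) simp_all
    qed
  qed
qed

lemma partial_latin_rectangle_mono:
  assumes "partial_latin_rectangle k n P" "P' \<subseteq>\<^sub>m P"
  shows "partial_latin_rectangle k n P'"
proof -
  have sub: "P p = Some x" if "P' p = Some x" for p x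
    using assms(2) that unfolding map_le_def by (metis domI)
  show ?thesis
    unfolding partial_latin_rectangle_def
  proof (intro conjI ballI)
    show "dom P' \<subseteq> {1..k} \<times> {1..n}"
      using assms(1) map_le_implies_dom_le[OF assms(2)] unfolding partial_latin_rectangle_def by blast
    have "ran P' \<subseteq> ran P" using sub by (fastforce simp: ran_def)
    then show "ran P' \<subseteq> {1..n}" using assms(1) unfolding partial_latin_rectangle_def by blast
    fix i s assume "i \<in> {1..k}" "s \<in> {1..n}"
    then have "\<exists>\<^sub>\<le>\<^sub>1j. j \<in> {1..n} \<and> P (i, j) = Some s"
      using assms(1) unfolding partial_latin_rectangle_def by blast
    then show "\<exists>\<^sub>\<le>\<^sub>1j. j \<in> {1..n} \<and> P' (i, j) = Some s" using sub unfolding Uniq_def by blast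
  next
    fix j s assume "j \<in> {1..n}" "s \<in> {1..n}"
    then have "\<exists>\<^sub>\<le>\<^sub>1i. i \<in> {1..k} \<and> P (i, j) = Some s"
      using assms(1) unfolding partial_latin_rectangle_def by blast
    then show "\<exists>\<^sub>\<le>\<^sub>1i. i \<in> {1..k} \<and> P' (i, j) = Some s" using sub unfolding Uniq_def by blast
  qed
qed

lemma removed_symbol_candidate:
  assumes P: "partial_latin_rectangle k n P" and e: "P (i, j) = Some x"
  shows "x \<in> candidates n (P((i, j) := None)) i j"
proof -
  have in_range: "r \<in> {1..k} \<and> c \<in> {1..n} \<and> y \<in> {1..n}" if "P (r, c) = Some y" for r c y
  proof -
    have "(r, c) \<in> dom P" "y \<in> ran P" using that by (auto simp: ran_def)
    then show ?thesis using P unfolding partial_latin_rectangle_def by blast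
  qed
  have "\<exists>\<^sub>\<le>\<^sub>1c. c \<in> {1..n} \<and> P (i, c) = Some x" "\<exists>\<^sub>\<le>\<^sub>1r. r \<in> {1..k} \<and> P (r, j) = Some x"
    using P in_range[OF e] unfolding partial_latin_rectangle_def by blast+
  then have "c = j" if "P (i, c) = Some x" for c using that e in_range unfolding Uniq_def by blast
  moreover have "r = i" if "P (r, j) = Some x" for r
    using that e in_range \<open>\<exists>\<^sub>\<le>\<^sub>1r. r \<in> {1..k} \<and> P (r, j) = Some x\<close> unfolding Uniq_def by blast
  ultimately show ?thesis using in_range[OF e] by (auto simp: candidates_def)
qed

lemma completions_bounds:
  fixes \<epsilon> :: real
  assumes \<epsilon>: "0 < \<epsilon>" "\<epsilon> < 1"
    and D: "0 < n - 2 * k - Suc f"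
    and small: "6 * real f * (real (n - 2 * k - Suc f) + real k) \<le> \<epsilon> / 4 * (real (n - 2 * k - Suc f))\<^sup>2"
    and f: "2 * real f \<le> \<epsilon> / 4 * real n"
    and "partial_latin_rectangle k n P" "sparse_array k n f P"
  shows "((1 - \<epsilon>) / real n) ^ card (dom P) * real (card (latin_rectangles k n)) \<le> real (card (completions k n P)) \<and>
    real (card (completions k n P)) \<le> ((1 + \<epsilon>) / real n) ^ card (dom P) * real (card (latin_rectangles k n))"
  using assms(6,7)
proof (induction "card (dom P)" arbitrary: P)
  case 0
  have "finite (dom P)" using sparse_array.dom_P[OF 0(3)] finite_subset by blast
  with 0 have "dom P = {}" by simp
  then have "completions k n P = latin_rectangles k n" by (auto simp: completions_def map_le_def)
  with 0(1) show ?case by simp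
next
  case (Suc l)
  have fin: "finite (dom P)" using sparse_array.dom_P[OF Suc(4)] finite_subset by blast
  then obtain i j x where e: "P (i, j) = Some x" using Suc(2) by (metis card.empty domD ex_in_conv nat.distinct(1) surj_pair)
  define P' where "P' = P((i, j) := None)"
  have le: "P' \<subseteq>\<^sub>m P" by (simp add: P'_def map_le_def)
  have "dom P' = dom P - {(i, j)}" by (simp add: P'_def)
  with e Suc(2) fin have l: "l = card (dom P')" by (simp add: card_Diff_singleton domI)
  have P': "partial_latin_rectangle k n P'" "sparse_array k n f P'"
    using partial_latin_rectangle_mono[OF Suc(3) le] sparse_array_mono[OF Suc(4) le] by auto
  have cell: "i \<in> {1..k}" "j \<in> {1..n}" using sparse_array.dom_P[OF Suc(4)] e by blast+
  have x: "x \<in> candidates n P' i j" unfolding P'_def by (rule removed_symbol_candidate[OF Suc(3) e])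
  have P: "P'((i, j) \<mapsto> x) = P" using e by (auto simp: P'_def)
  have ratio: "(1 - \<epsilon>) / real n * real (card (completions k n P')) \<le> real (card (completions k n P))"
    "real (card (completions k n P)) \<le> (1 + \<epsilon>) / real n * real (card (completions k n P'))"
    using sparse_array.completions_ratio[OF P'(2) cell _ x \<epsilon> refl D small f] P by (auto simp: P'_def)
  let ?N = "real (card (latin_rectangles k n))" and ?C = "real (card (completions k n P'))"
  have IH: "((1 - \<epsilon>) / real n) ^ l * ?N \<le> ?C" "?C \<le> ((1 + \<epsilon>) / real n) ^ l * ?N"
    using Suc(1)[OF l P'] l by auto
  have "(1 - \<epsilon>) / real n * (((1 - \<epsilon>) / real n) ^ l * ?N) \<le> (1 - \<epsilon>) / real n * ?C"
    using IH(1) \<epsilon> by (intro mult_left_mono) auto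
  moreover have "(1 + \<epsilon>) / real n * ?C \<le> (1 + \<epsilon>) / real n * (((1 + \<epsilon>) / real n) ^ l * ?N)"
    using IH(2) \<epsilon> by (intro mult_left_mono) auto
  ultimately show ?case using ratio unfolding Suc(2)[symmetric] power_Suc mult.assoc by linarith
qed

lemma sparse_arrayI:
  assumes P: "partial_latin_rectangle k n P" and C: "C_sparse C k n P"
  shows "sparse_array k n (nat \<lfloor>C\<rfloor>) P"
proof
  show "dom P \<subseteq> {1..k} \<times> {1..n}" using P unfolding partial_latin_rectangle_def by blast
  have le: "m \<le> nat \<lfloor>C\<rfloor>" if "real m \<le> C" for m using that by (simp add: le_nat_floor)
  show "card {c \<in> {1..n}. P (r, c) \<noteq> None} \<le> nat \<lfloor>C\<rfloor>" if "r \<in> {1..k}" for r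
    using C that unfolding C_sparse_def by (intro le) blast
  show "card {r \<in> {1..k}. P (r, c) \<noteq> None} \<le> nat \<lfloor>C\<rfloor>" if "c \<in> {1..n}" for c
    using C that unfolding C_sparse_def by (intro le) blast
  show "card {p \<in> {1..k} \<times> {1..n}. P p = Some x} \<le> nat \<lfloor>C\<rfloor>" if "x \<in> {1..n}" for x
    using C that unfolding C_sparse_def by (intro le) blast
qed

theorem theorem1p6:
  fixes \<epsilon> \<alpha> :: real
  assumes "0 < \<epsilon>" "\<epsilon> < 1" "0 < \<alpha>"
  shows "\<exists>\<beta>>0. \<exists>n\<^sub>0 :: nat. \<forall>n\<ge>n\<^sub>0. \<forall>k :: nat. \<forall>P :: array.
    0 < k \<longrightarrow> real k < (1/2 - \<alpha>) * real n \<longrightarrow>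
    partial_latin_rectangle k n P \<longrightarrow> C_sparse (\<beta> * real n) k n P \<longrightarrow>
    ((1 - \<epsilon>) / real n) ^ card (dom P)
      \<le> measure_pmf.prob (pmf_of_set (latin_rectangles k n)) {L. P \<subseteq>\<^sub>m L} \<and>
    measure_pmf.prob (pmf_of_set (latin_rectangles k n)) {L. P \<subseteq>\<^sub>m L}
      \<le> ((1 + \<epsilon>) / real n) ^ card (dom P)"
proof -
  \<comment> \<open>The three terms ensure, in this order, that at least \<open>\<alpha> n\<close> switches remain, that at least \<open>(1 - \<epsilon> / 4) n\<close> symbols are allowed in a cell, and that few components meet a bad row.\<close>
  define \<beta> where "\<beta> = Min {\<alpha> / 2, \<epsilon> / 8, \<epsilon> * \<alpha>\<^sup>2 / (24 * (\<alpha> + 1))}"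
  have \<beta>: "0 < \<beta>" "\<beta> \<le> \<alpha> / 2" "\<beta> \<le> \<epsilon> / 8" "\<beta> \<le> \<epsilon> * \<alpha>\<^sup>2 / (24 * (\<alpha> + 1))"
    unfolding \<beta>_def by (subst Min_gr_iff, use assms in auto)[] (intro Min_le; simp)+
  \<comment> \<open>This makes \<open>\<alpha> n \<ge> 2\<close>, which absorbs the column protected in addition to those of \<open>P\<close>.\<close>
  define n0 where "n0 = nat \<lceil>2 / \<alpha>\<rceil> + 1"
  show ?thesis
  proof (intro exI[of _ \<beta>] conjI exI[of _ n0] allI impI \<beta>(1))
    fix n k P
    assume n0: "n0 \<le> n" and k0: "0 < k" and k: "real k < (1/2 - \<alpha>) * real n"
      and P: "partial_latin_rectangle k n P" and C: "C_sparse (\<beta> * real n) k n P"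
    define f where "f = nat \<lfloor>\<beta> * real n\<rfloor>"
    define D where "D = n - 2 * k - Suc f"
    have n: "0 < n" "2 / \<alpha> \<le> real n" using n0 unfolding n0_def by linarith+
    then have \<alpha>n: "2 \<le> \<alpha> * real n" using assms(3) by (simp add: field_simps)
    have f: "real f \<le> \<beta> * real n" using \<beta>(1) n by (simp add: f_def)
    have "\<beta> * real n \<le> \<alpha> / 2 * real n" using \<beta>(2) by (intro mult_right_mono) auto
    then have "\<beta> * real n \<le> (\<alpha> * real n) / 2" by simp
    moreover have "2 * real k < real n - 2 * (\<alpha> * real n)" using k by (simp add: algebra_simps)
    ultimately have D_real: "\<alpha> * real n \<le> real n - 2 * real k - (real f + 1)"
      using f \<alpha>n by linarith
    then have "2 * k + Suc f \<le> n" using \<alpha>n by linarith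
    then have "real D = real n - 2 * real k - (real f + 1)" by (simp add: D_def of_nat_diff)
    with D_real have D: "\<alpha> * real n \<le> real D" by linarith
    then have D0: "0 < D" using \<alpha>n by linarith
    have kn: "real k \<le> real n"
    proof -
      have "(1/2 - \<alpha>) * real n \<le> 1 * real n" using assms(3) by (intro mult_right_mono) auto
      then show ?thesis using k by linarith
    qed
    have "6 * real f * (real D + real k) \<le> \<epsilon> / 4 * (real D)\<^sup>2"
    proof -
      have "\<alpha> * (real D + real k) \<le> \<alpha> * real D + \<alpha> * real n"
        using kn assms(3) by (simp add: distrib_left)
      also have "\<dots> \<le> (\<alpha> + 1) * real D" using D by (simp add: algebra_simps)
      finally have Dk: "\<alpha> * (real D + real k) \<le> (\<alpha> + 1) * real D" .
      have "real f * (24 * (\<alpha> + 1)) \<le> \<beta> * real n * (24 * (\<alpha> + 1))"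
        using f assms(3) by (intro mult_right_mono) auto
      also have "\<dots> = \<beta> * (24 * (\<alpha> + 1)) * real n" by (simp only: mult_ac)
      also have "\<dots> \<le> \<epsilon> * \<alpha>\<^sup>2 * real n"
        using \<beta>(4) assms(3) by (intro mult_right_mono) (auto simp: pos_le_divide_eq)
      also have "\<dots> = \<epsilon> * \<alpha> * (\<alpha> * real n)" by (simp add: power2_eq_square)
      also have "\<dots> \<le> \<epsilon> * \<alpha> * real D" using D assms by (intro mult_left_mono) auto
      finally have F: "real f * (24 * (\<alpha> + 1)) \<le> \<epsilon> * \<alpha> * real D" .
      have "\<alpha> * (24 * real f * (real D + real k)) = 24 * real f * (\<alpha> * (real D + real k))" by (simp only: mult_ac)
      also have "\<dots> \<le> 24 * real f * ((\<alpha> + 1) * real D)" using Dk by (intro mult_left_mono) auto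
      also have "\<dots> = real f * (24 * (\<alpha> + 1)) * real D" by (simp only: mult_ac)
      also have "\<dots> \<le> \<epsilon> * \<alpha> * real D * real D" using F by (intro mult_right_mono) auto
      also have "\<dots> = \<alpha> * (\<epsilon> * (real D)\<^sup>2)" by (simp add: power2_eq_square)
      finally have "24 * real f * (real D + real k) \<le> \<epsilon> * (real D)\<^sup>2" using assms(3) by simp
      then show ?thesis by simp
    qed
    moreover have "2 * real f \<le> \<epsilon> / 4 * real n"
    proof -
      have "\<beta> * real n \<le> \<epsilon> / 8 * real n" using \<beta>(3) by (intro mult_right_mono) auto
      with f show ?thesis by simp
    qed
    moreover have "sparse_array k n f P" unfolding f_def by (rule sparse_arrayI[OF P C])
    ultimately have bounds:
      "((1 - \<epsilon>) / real n) ^ card (dom P) * real (card (latin_rectangles k n)) \<le> real (card (completions k n P))"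
      "real (card (completions k n P)) \<le> ((1 + \<epsilon>) / real n) ^ card (dom P) * real (card (latin_rectangles k n))"
      using completions_bounds[OF assms(1,2), of n k f P] D0 P unfolding D_def by auto
    have ne: "latin_rectangles k n \<noteq> {}" using kn by (intro latin_rectangles_nonempty) simp
    then have pos: "0 < real (card (latin_rectangles k n))"
      using finite_latin_rectangles by (simp add: card_gt_0_iff)
    have prob: "measure_pmf.prob (pmf_of_set (latin_rectangles k n)) {L. P \<subseteq>\<^sub>m L}
      = real (card (completions k n P)) / real (card (latin_rectangles k n))"
      by (simp add: measure_pmf_of_set[OF ne finite_latin_rectangles] completions_def Collect_conj_eq)
    show "((1 - \<epsilon>) / real n) ^ card (dom P)
        \<le> measure_pmf.prob (pmf_of_set (latin_rectangles k n)) {L. P \<subseteq>\<^sub>m L}"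
      "measure_pmf.prob (pmf_of_set (latin_rectangles k n)) {L. P \<subseteq>\<^sub>m L}
        \<le> ((1 + \<epsilon>) / real n) ^ card (dom P)"
      unfolding prob using bounds pos by (simp_all add: pos_le_divide_eq pos_divide_le_eq)
  qed
qed

end
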